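(* Let $0<\alpha<1$, $l,T>0$, $k(t)\ge c_1>0$ and $q(t)\ge0$ continuous on $[0,T]$, $f$ continuous on $[0,l]\times[0,T]$. Assume $u$, which has continuous partial derivatives up to order $6$ in $x$ and up to order $3$ in $t$ on $[0,l]\times[0,T]$, solves $$\partial_{0t}^\alpha u=k(t)\frac{\partial^2u}{\partial x^2}-q(t)u+f(x,t),\ 0<x<l,\ 0<t\le T;\quad u(0,t)=u(l,t)=0;\quad u(x,0)=u_0(x).$$ Let $\{y_i^j\}$ be the solution of the difference scheme $$\Delta^\alpha_{0t_{j+\sigma}}\mathcal H_hy_i=a^{j+1}y^{(\sigma)}_{\bar xx,i}-d^{j+1}\mathcal H_hy_i^{(\sigma)}+\mathcal H_h\varphi_i^{j+1}\ (1\le i\le N-1,\ 0\le j\le M-1),\quad y_0^j=y_N^j=0,\quad y_i^0=u_0(x_i),$$ with $\sigma=1-\alpha/2$, $h=l/N$, $x_i=ih$, $\tau=T/M$, $t_j=j\tau$, $t_{j+\sigma}=(j+\sigma)\tau$, $a^{j+1}=k(t_{j+\sigma})$, $d^{j+1}=q(t_{j+\sigma})$, $\varphi_i^{j+1}=f(x_i,t_{j+\sigma})$. Then there is a constant $C_R>0$ independent of $\tau$ and $h$ such that $$\|u(\cdot,t_j)-y^j\|_0\le C_R(\tau^2+h^4),\qquad 1\le j\le M .$$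
   Context: Caputo derivative: $\partial_{0t}^\alpha u(x,t)=\frac{1}{\Gamma(1-\alpha)}\int_0^t\partial_\eta u(x,\eta)(t-\eta)^{-\alpha}d\eta$. Mesh notation: $(y,v)=\sum_{i=1}^{N-1}y_iv_ih$, $\|y\|_0^2=(y,y)$; $v_{\bar xx,i}=(v_{i+1}-2v_i+v_{i-1})/h^2$; $\mathcal H_hv_i=v_i+\frac{h^2}{12}v_{\bar xx,i}$; $y^{(\sigma)}=\sigma y^{j+1}+(1-\sigma)y^j$. Discrete fractional derivative: $\Delta^\alpha_{0t_{j+\sigma}}w=\frac{\tau^{1-\alpha}}{\Gamma(2-\alpha)}\sum_{s=0}^{j}c_{j-s}\frac{w^{s+1}-w^s}{\tau}$, with $a_0=\sigma^{1-\alpha}$, $a_m=(m+\sigma)^{1-\alpha}-(m-1+\sigma)^{1-\alpha}$ ($m\ge1$), $b_m=\frac{1}{2-\alpha}[(m+\sigma)^{2-\alpha}-(m-1+\sigma)^{2-\alpha}]-\frac12[(m+\sigma)^{1-\alpha}+(m-1+\sigma)^{1-\alpha}]$ ($m\ge1$); for $j=0$, $c_0=a_0$; for $j\ge1$, $c_0=a_0+b_1$, $c_s=a_s+b_{s+1}-b_s$ ($1\le s\le j-1$), $c_j=a_j-b_j$. *)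

theory Defs
  imports "HOL-Analysis.Analysis"
begin

definition caputo :: "real \<Rightarrow> (real \<Rightarrow> real) \<Rightarrow> real \<Rightarrow> real" where
  "caputo \<alpha> g t = 1 / Gamma (1 - \<alpha>) * integral {0..t} (\<lambda>\<eta>. deriv g \<eta> * (t - \<eta>) powr (- \<alpha>))"

definition smooth_6_3 :: "(real \<Rightarrow> real \<Rightarrow> real) \<Rightarrow> real \<Rightarrow> real \<Rightarrow> bool" where
  "smooth_6_3 u l T \<longleftrightarrow>
    (\<exists>D :: nat \<Rightarrow> nat \<Rightarrow> real \<Rightarrow> real \<Rightarrow> real.
       (\<forall>x\<in>{0..l}. \<forall>t\<in>{0..T}. D 0 0 x t = u x t) \<and>
       (\<forall>a\<le>6. \<forall>b\<le>3. continuous_on ({0..l} \<times> {0..T}) (\<lambda>(x, t). D a b x t)) \<and>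
       (\<forall>a<6. \<forall>b\<le>3. \<forall>x\<in>{0..l}. \<forall>t\<in>{0..T}.
          ((\<lambda>s. D a b s t) has_real_derivative D (Suc a) b x t) (at x within {0..l})) \<and>
       (\<forall>a\<le>6. \<forall>b<3. \<forall>x\<in>{0..l}. \<forall>t\<in>{0..T}.
          ((\<lambda>s. D a b x s) has_real_derivative D a (Suc b) x t) (at t within {0..T})))"

definition coef_a :: "real \<Rightarrow> real \<Rightarrow> nat \<Rightarrow> real" where
  "coef_a \<alpha> \<sigma> m = (if m = 0 then \<sigma> powr (1 - \<alpha>)
     else (real m + \<sigma>) powr (1 - \<alpha>) - (real m - 1 + \<sigma>) powr (1 - \<alpha>))"

definition coef_b :: "real \<Rightarrow> real \<Rightarrow> nat \<Rightarrow> real" where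
  "coef_b \<alpha> \<sigma> m = 1 / (2 - \<alpha>) * ((real m + \<sigma>) powr (2 - \<alpha>) - (real m - 1 + \<sigma>) powr (2 - \<alpha>))
     - 1 / 2 * ((real m + \<sigma>) powr (1 - \<alpha>) + (real m - 1 + \<sigma>) powr (1 - \<alpha>))"

definition coef_c :: "real \<Rightarrow> real \<Rightarrow> nat \<Rightarrow> nat \<Rightarrow> real" where
  "coef_c \<alpha> \<sigma> j s =
     (if j = 0 then coef_a \<alpha> \<sigma> 0
      else if s = 0 then coef_a \<alpha> \<sigma> 0 + coef_b \<alpha> \<sigma> 1
      else if s < j then coef_a \<alpha> \<sigma> s + coef_b \<alpha> \<sigma> (s + 1) - coef_b \<alpha> \<sigma> s
      else coef_a \<alpha> \<sigma> j - coef_b \<alpha> \<sigma> j)"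

definition disc_frac :: "real \<Rightarrow> real \<Rightarrow> real \<Rightarrow> nat \<Rightarrow> (nat \<Rightarrow> real) \<Rightarrow> real" where
  "disc_frac \<alpha> \<sigma> \<tau> j w = \<tau> powr (1 - \<alpha>) / Gamma (2 - \<alpha>) *
     (\<Sum>s = 0..j. coef_c \<alpha> \<sigma> j (j - s) * ((w (s + 1) - w s) / \<tau>))"

definition sdiff :: "real \<Rightarrow> (nat \<Rightarrow> real) \<Rightarrow> nat \<Rightarrow> real" where
  "sdiff h v i = (v (i + 1) - 2 * v i + v (i - 1)) / h\<^sup>2"

definition Hh :: "real \<Rightarrow> (nat \<Rightarrow> real) \<Rightarrow> nat \<Rightarrow> real" where
  "Hh h v i = v i + h\<^sup>2 / 12 * sdiff h v i"

definition norm0 :: "real \<Rightarrow> nat \<Rightarrow> (nat \<Rightarrow> real) \<Rightarrow> real" where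
  "norm0 h N v = sqrt (\<Sum>i = 1..N - 1. (v i)\<^sup>2 * h)"

end

theory Submission
  imports Defs
begin

text \<open>
  The error \<open>z = u - y\<close> solves the scheme with a residual \<open>\<psi> = O(\<tau>\<^sup>2 + h\<^sup>4)\<close> as source term.
  In time, the Caputo integral is replaced on every cell by the integral of the derivative of the
  quadratic interpolant (of the linear one on the last, incomplete cell), which is \<open>O(\<tau>\<^sup>2)\<close>-close to
  \<open>\<partial>\<^sub>t u\<close>; integrating it exactly against the kernel produces the coefficients \<open>c\<^sub>s\<close>.
  In space, \<open>H\<^sub>h\<close> applied to \<open>\<partial>\<^sub>x\<^sub>x u\<close> absorbs the leading error of the second difference.

  For stability, multiply the scheme by \<open>H\<^sub>h z\<^bsup>(\<sigma>)\<^esup>\<close> and sum over the space grid. The coefficients \<open>c\<^sub>s\<close> are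
  decreasing in \<open>s\<close> with \<open>\<sigma>\<^sup>2 c\<^sub>1 \<le> (2\<sigma> - 1) c\<^sub>0\<close>, so the left-hand side dominates half of the discrete
  fractional derivative of \<open>\<parallel>H\<^sub>h z\<parallel>\<^sup>2\<close>, while the diffusion term together with a discrete
  Poincare inequality absorbs \<open>(\<psi>, H\<^sub>h z\<^bsup>(\<sigma>)\<^esup>)\<close>. Since \<open>c\<^sub>j \<ge> (1 - \<alpha>) (j + \<sigma>)\<^bsup>-\<alpha>\<^esup>\<close>, a comparison argument bounds
  \<open>\<parallel>H\<^sub>h z\<parallel>\<close> by a multiple of \<open>max \<bar>\<psi>\<bar>\<close>.
\<close>

section \<open>The coefficients of the discrete fractional derivative\<close>

text \<open>For positive \<alpha> the integrand is unbounded at \<theta>, while the antiderivative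
  stays continuous there because 1 - \<alpha> > 0. The interior form of the fundamental theorem
  therefore also covers a cell that ends at the singularity.\<close>

lemma powr_kernel_has_integral:
  fixes \<alpha> \<theta> A B :: real
  assumes "\<alpha> < 1" "A \<le> B" "B \<le> \<theta>"
  shows "((\<lambda>\<eta>. (\<theta> - \<eta>) powr (- \<alpha>)) has_integral
    ((\<theta> - A) powr (1 - \<alpha>) - (\<theta> - B) powr (1 - \<alpha>)) / (1 - \<alpha>)) {A..B}"
proof -
  let ?G = "\<lambda>\<eta>. - ((\<theta> - \<eta>) powr (1 - \<alpha>)) / (1 - \<alpha>)"
  have "((\<lambda>\<eta>. (\<theta> - \<eta>) powr (- \<alpha>)) has_integral (?G B - ?G A)) {A..B}"
  proof (rule fundamental_theorem_of_calculus_interior)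
    show "continuous_on {A..B} ?G"
      using assms by (auto intro!: continuous_intros continuous_on_powr')
    fix x assume "x \<in> {A<..<B}"
    then show "(?G has_vector_derivative (\<theta> - x) powr (- \<alpha>)) (at x)"
      using assms
      by (auto intro!: derivative_eq_intros simp: divide_simps simp flip: has_real_derivative_iff_has_vector_derivative)
  qed (use assms in auto)
  then show ?thesis using assms by (simp add: diff_divide_distrib)
qed

text \<open>\<open>G\<close> comes from integration by parts: the factor \<open>\<eta> - c\<close>
  is differentiated and the kernel is integrated.\<close>

lemma powr_kernel_moment_has_integral:
  fixes \<alpha> \<theta> A B c :: real
  assumes "\<alpha> < 1" "A \<le> B" "B \<le> \<theta>"
  defines "G \<equiv> \<lambda>\<eta>. - (\<eta> - c) * (\<theta> - \<eta>) powr (1 - \<alpha>) / (1 - \<alpha>)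
    - (\<theta> - \<eta>) powr (2 - \<alpha>) / ((1 - \<alpha>) * (2 - \<alpha>))"
  shows "((\<lambda>\<eta>. (\<eta> - c) * (\<theta> - \<eta>) powr (- \<alpha>)) has_integral G B - G A) {A..B}"
proof (rule fundamental_theorem_of_calculus_interior)
  show "continuous_on {A..B} G"
    unfolding G_def using assms by (auto intro!: continuous_intros continuous_on_powr')
  fix x assume x: "x \<in> {A<..<B}"
  have "((\<lambda>\<eta>. (\<theta> - \<eta>) powr (1 - \<alpha>)) has_real_derivative - ((1 - \<alpha>) * (\<theta> - x) powr (- \<alpha>))) (at x)"
    using x assms by (auto intro!: derivative_eq_intros simp: divide_simps)
  moreover have "((\<lambda>\<eta>. (\<theta> - \<eta>) powr (2 - \<alpha>)) has_real_derivative - ((2 - \<alpha>) * (\<theta> - x) powr (1 - \<alpha>))) (at x)"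
    using x assms by (auto intro!: derivative_eq_intros simp: divide_simps)
  moreover have "((\<lambda>\<eta>. - (\<eta> - c)) has_real_derivative - 1) (at x)"
    by (auto intro!: derivative_eq_intros)
  ultimately have "(G has_real_derivative
      (- 1 * (\<theta> - x) powr (1 - \<alpha>) + (- ((1 - \<alpha>) * (\<theta> - x) powr (- \<alpha>))) * - (x - c)) / (1 - \<alpha>)
      - (- ((2 - \<alpha>) * (\<theta> - x) powr (1 - \<alpha>))) / ((1 - \<alpha>) * (2 - \<alpha>))) (at x)"
    unfolding G_def by (intro DERIV_diff DERIV_cdivide DERIV_mult)
  moreover have "(- 1 * (\<theta> - x) powr (1 - \<alpha>) + (- ((1 - \<alpha>) * (\<theta> - x) powr (- \<alpha>))) * - (x - c)) / (1 - \<alpha>)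
      - (- ((2 - \<alpha>) * (\<theta> - x) powr (1 - \<alpha>))) / ((1 - \<alpha>) * (2 - \<alpha>)) = (x - c) * (\<theta> - x) powr (- \<alpha>)"
    using assms by (simp add: divide_simps) (simp add: algebra_simps)
  ultimately show "(G has_vector_derivative (x - c) * (\<theta> - x) powr (- \<alpha>)) (at x)"
    by (simp add: has_real_derivative_iff_has_vector_derivative)
qed (use assms in auto)

text \<open>The weight \<open>x - 1 / 2\<close> has mean zero, so \<open>f (1 / 2)\<close> may be
  subtracted from \<open>f\<close>. For monotone \<open>f\<close> the two factors then have the same
  sign, and their product is at most half the variation of \<open>f\<close>.\<close>

lemma has_integral_centered_mono:
  fixes f :: "real \<Rightarrow> real"
  assumes "mono_on {0..1} f" "((\<lambda>x. (x - 1 / 2) * f x) has_integral I) {0..1}"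
  shows "0 \<le> I" "I \<le> (f 1 - f 0) / 2"
proof -
  have "((\<lambda>x::real. x - 1 / 2) has_integral (1\<^sup>2 / 2 - 1 / 2 * 1) - (0\<^sup>2 / 2 - 1 / 2 * 0)) {0..1}"
    by (rule fundamental_theorem_of_calculus)
       (auto intro!: derivative_eq_intros simp flip: has_real_derivative_iff_has_vector_derivative)
  then have "((\<lambda>x::real. (x - 1 / 2) * f (1 / 2)) has_integral 0 * f (1 / 2)) {0..1}"
    by (intro has_integral_mult_left) (simp add: power2_eq_square)
  from has_integral_diff[OF assms(2) this]
  have I: "((\<lambda>x. (x - 1 / 2) * (f x - f (1 / 2))) has_integral I) {0..1}"
    by (simp add: algebra_simps)
  have m: "f x \<le> f y" if "0 \<le> x" "x \<le> y" "y \<le> 1" for x y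
    using that by (intro mono_onD[OF assms(1)]) auto
  have pos: "0 \<le> (x - 1 / 2) * (f x - f (1 / 2))" if "x \<in> {0..1}" for x
    using that m[of x "1/2"] m[of "1/2" x] by (cases "x \<le> 1 / 2") (auto simp: zero_le_mult_iff)
  show "0 \<le> I" by (rule has_integral_nonneg[OF I]) (use pos in auto)
  have c: "((\<lambda>x. (f 1 - f 0) / 2) has_integral (f 1 - f 0) / 2) {0..1::real}"
    using has_integral_const_real[of "(f 1 - f 0) / 2" 0 1] by simp
  show "I \<le> (f 1 - f 0) / 2"
  proof (rule has_integral_le[OF I c])
    fix x :: real assume x: "x \<in> {0..1}"
    have "\<bar>x - 1 / 2\<bar> * \<bar>f x - f (1 / 2)\<bar> \<le> 1 / 2 * (f 1 - f 0)"
      using x m[of 0 x] m[of x 1] m[of 0 "1/2"] m[of "1/2" 1]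
      by (intro mult_mono) (auto simp: abs_if)
    then show "(x - 1 / 2) * (f x - f (1 / 2)) \<le> (f 1 - f 0) / 2"
      using abs_ge_self[of "(x - 1 / 2) * (f x - f (1 / 2))"] unfolding abs_mult by linarith
  qed
qed

section \<open>The coefficients a and b as moments of the kernel\<close>

lemma coef_a_has_integral:
  assumes "\<alpha> < 1" "0 < \<sigma>" "m \<ge> 1"
  shows "((\<lambda>x. (real m + \<sigma> - x) powr (- \<alpha>)) has_integral coef_a \<alpha> \<sigma> m / (1 - \<alpha>)) {0..1}"
  using powr_kernel_has_integral[of \<alpha> 0 1 "real m + \<sigma>"] assms
  by (simp add: coef_a_def algebra_simps)

text \<open>Up to the factor 1 - \<alpha>, a is the mass of the kernel on a unit cell and b its
  first moment about the midpoint. Signs and monotonicity of the coefficients can thus be read off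
  from the shape of the kernel.\<close>

lemma coef_b_has_integral:
  assumes "\<alpha> < 1" "0 < \<sigma>" "m \<ge> 1"
  shows "((\<lambda>x. (x - 1 / 2) * (real m + \<sigma> - x) powr (- \<alpha>)) has_integral coef_b \<alpha> \<sigma> m / (1 - \<alpha>)) {0..1}"
proof -
  have eq: "(real m + \<sigma> - 1) = (real m - 1 + \<sigma>)" by simp
  have alg: "(- (1 - 1 / 2) * q1 / (1 - \<alpha>) - q2 / ((1 - \<alpha>) * (2 - \<alpha>)))
      - (- (0 - 1 / 2) * p1 / (1 - \<alpha>) - p2 / ((1 - \<alpha>) * (2 - \<alpha>)))
    = (1 / (2 - \<alpha>) * (p2 - q2) - 1 / 2 * (p1 + q1)) / (1 - \<alpha>)" for p1 p2 q1 q2 :: real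
    using assms by (simp add: divide_simps) (simp add: algebra_simps)
  show ?thesis
    using powr_kernel_moment_has_integral[of \<alpha> 0 1 "real m + \<sigma>" "1 / 2"] assms
    unfolding alg coef_b_def eq by simp
qed

text \<open>This is convexity of x to the power -\<alpha>: its derivative is increasing, so the drop
  over a unit step shrinks as the step moves to the right.\<close>

lemma powr_minus_diff_antimono:
  fixes \<alpha> p q :: real
  assumes "0 < \<alpha>" "0 < q" "q \<le> p"
  shows "p powr (- \<alpha>) - (p + 1) powr (- \<alpha>) \<le> q powr (- \<alpha>) - (q + 1) powr (- \<alpha>)"
proof (rule DERIV_nonpos_imp_nonincreasing[OF assms(3)])
  fix x assume "q \<le> x" "x \<le> p"
  then have x: "x > 0" using assms by simp
  have "((\<lambda>x. x powr (- \<alpha>) - (x + 1) powr (- \<alpha>)) has_real_derivative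
      (- \<alpha>) * x powr (- \<alpha> - 1) - (- \<alpha>) * (x + 1) powr (- \<alpha> - 1)) (at x)"
    using x by (auto intro!: derivative_eq_intros)
  moreover have "(x + 1) powr (- \<alpha> - 1) \<le> x powr (- \<alpha> - 1)"
    using x assms by (intro powr_mono2') auto
  then have "(- \<alpha>) * x powr (- \<alpha> - 1) - (- \<alpha>) * (x + 1) powr (- \<alpha> - 1) \<le> 0"
    using assms by simp
  ultimately show "\<exists>y. ((\<lambda>x. x powr (- \<alpha>) - (x + 1) powr (- \<alpha>)) has_real_derivative y) (at x) \<and> y \<le> 0"
    by blast
qed

context
  fixes \<alpha> \<sigma> :: real
  assumes \<alpha>: "0 < \<alpha>" "\<alpha> < 1" and \<sigma>: "0 < \<sigma>"
begin

lemma kernel_mono_on: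
  assumes "m \<ge> 1"
  shows "mono_on {0..1} (\<lambda>x. (real m + \<sigma> - x) powr (- \<alpha>))"
  using assms \<alpha> \<sigma> by (intro mono_onI powr_mono2') auto

lemma coef_b_nonneg: "m \<ge> 1 \<Longrightarrow> 0 \<le> coef_b \<alpha> \<sigma> m"
  using has_integral_centered_mono(1)[OF kernel_mono_on coef_b_has_integral[of \<alpha> \<sigma> m]] \<alpha> \<sigma>
  by (simp add: zero_le_divide_iff)

text \<open>The difference of two consecutive coefficients is the centered moment of the difference
  of the two kernels, which is increasing on the cell by convexity.\<close>

lemma coef_b_antimono:
  assumes "m \<ge> 1"
  shows "coef_b \<alpha> \<sigma> (m + 1) \<le> coef_b \<alpha> \<sigma> m"
proof -
  let ?f = "\<lambda>x. (real m + \<sigma> - x) powr (- \<alpha>) - (real (m + 1) + \<sigma> - x) powr (- \<alpha>)"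
  have "((\<lambda>x. (x - 1 / 2) * ?f x) has_integral
      coef_b \<alpha> \<sigma> m / (1 - \<alpha>) - coef_b \<alpha> \<sigma> (m + 1) / (1 - \<alpha>)) {0..1}"
    using has_integral_diff[OF coef_b_has_integral[of \<alpha> \<sigma> m] coef_b_has_integral[of \<alpha> \<sigma> "m + 1"]] assms \<alpha> \<sigma>
    unfolding right_diff_distrib by simp
  moreover have "mono_on {0..1} ?f"
  proof (rule mono_onI)
    fix x y :: real assume "x \<in> {0..1}" "y \<in> {0..1}" "x \<le> y"
    then show "?f x \<le> ?f y"
      using powr_minus_diff_antimono[of \<alpha> "real m + \<sigma> - y" "real m + \<sigma> - x"] assms \<alpha> \<sigma>
      by (simp add: algebra_simps)
  qed
  ultimately have "0 \<le> coef_b \<alpha> \<sigma> m / (1 - \<alpha>) - coef_b \<alpha> \<sigma> (m + 1) / (1 - \<alpha>)"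
    by (rule has_integral_centered_mono(1)[rotated])
  then show ?thesis using \<alpha> by (simp add: divide_le_cancel)
qed

text \<open>The weight \<open>3 / 2 - x\<close> is positive on the unit cell and has integral 1.
  Hence a - b is 1 - \<alpha> times a weighted mean of the kernel and lies between the corresponding
  multiples of its end values.\<close>

lemma coef_diff_has_integral:
  assumes "m \<ge> 1"
  shows "((\<lambda>x. (3 / 2 - x) * (real m + \<sigma> - x) powr (- \<alpha>)) has_integral
    (coef_a \<alpha> \<sigma> m - coef_b \<alpha> \<sigma> m) / (1 - \<alpha>)) {0..1}"
  using has_integral_diff[OF coef_a_has_integral[of \<alpha> \<sigma> m] coef_b_has_integral[of \<alpha> \<sigma> m]] assms \<alpha> \<sigma>
  by (simp add: algebra_simps diff_divide_distrib)

lemma three_halves_has_integral: "((\<lambda>x. (3 / 2 - x) * C) has_integral C) {0..1::real}"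
proof -
  have "((\<lambda>x::real. 3 / 2 - x) has_integral (3 / 2 * 1 - 1\<^sup>2 / 2) - (3 / 2 * 0 - 0\<^sup>2 / 2)) {0..1}"
    by (rule fundamental_theorem_of_calculus)
       (auto intro!: derivative_eq_intros simp flip: has_real_derivative_iff_has_vector_derivative)
  from has_integral_mult_left[OF this, of C] show ?thesis by simp
qed

lemma coef_diff_lower:
  assumes "m \<ge> 1"
  shows "(1 - \<alpha>) * (real m + \<sigma>) powr (- \<alpha>) \<le> coef_a \<alpha> \<sigma> m - coef_b \<alpha> \<sigma> m"
proof -
  have "(real m + \<sigma>) powr (- \<alpha>) \<le> (coef_a \<alpha> \<sigma> m - coef_b \<alpha> \<sigma> m) / (1 - \<alpha>)"
    by (rule has_integral_le[OF three_halves_has_integral coef_diff_has_integral[OF assms]])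
       (use assms \<alpha> \<sigma> in \<open>auto intro!: mult_left_mono powr_mono2'\<close>)
  then show ?thesis using \<alpha> by (simp add: field_simps)
qed

lemma coef_diff_1_upper: "coef_a \<alpha> \<sigma> 1 - coef_b \<alpha> \<sigma> 1 \<le> (1 - \<alpha>) * \<sigma> powr (- \<alpha>)"
proof -
  have "(coef_a \<alpha> \<sigma> 1 - coef_b \<alpha> \<sigma> 1) / (1 - \<alpha>) \<le> \<sigma> powr (- \<alpha>)"
    by (rule has_integral_le[OF coef_diff_has_integral[OF order_refl] three_halves_has_integral])
       (use \<alpha> \<sigma> in \<open>auto intro!: mult_left_mono powr_mono2'\<close>)
  then show ?thesis using \<alpha> by (simp add: field_simps)
qed

lemma coef_diff_antimono:
  assumes "m \<ge> 1"
  shows "coef_a \<alpha> \<sigma> (m + 1) - coef_b \<alpha> \<sigma> (m + 1) \<le> coef_a \<alpha> \<sigma> m - coef_b \<alpha> \<sigma> m"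
proof -
  have "(coef_a \<alpha> \<sigma> (m + 1) - coef_b \<alpha> \<sigma> (m + 1)) / (1 - \<alpha>) \<le> (coef_a \<alpha> \<sigma> m - coef_b \<alpha> \<sigma> m) / (1 - \<alpha>)"
  proof (rule has_integral_le[OF coef_diff_has_integral coef_diff_has_integral])
    show "(3 / 2 - x) * (real (m + 1) + \<sigma> - x) powr (- \<alpha>) \<le> (3 / 2 - x) * (real m + \<sigma> - x) powr (- \<alpha>)"
      if "x \<in> {0..1}" for x
      using assms that \<alpha> \<sigma> by (intro mult_left_mono powr_mono2') auto
  qed (use assms in auto)
  then show ?thesis using \<alpha> by (simp add: divide_le_cancel)
qed

lemma coef_b_2_upper: "coef_b \<alpha> \<sigma> 2 \<le> (1 - \<alpha>) * (\<alpha> / 2 * \<sigma> powr (- \<alpha>))"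
proof -
  have "coef_b \<alpha> \<sigma> 2 / (1 - \<alpha>) \<le> ((real 2 + \<sigma> - 1) powr (- \<alpha>) - (real 2 + \<sigma> - 0) powr (- \<alpha>)) / 2"
    using has_integral_centered_mono(2)[OF kernel_mono_on[of 2] coef_b_has_integral[of \<alpha> \<sigma> 2]] \<alpha> \<sigma> by simp
  also have "\<dots> = ((1 + \<sigma>) powr (- \<alpha>) - (2 + \<sigma>) powr (- \<alpha>)) / 2" by (simp add: add.commute)
  also have "\<dots> \<le> (\<alpha> * \<sigma> powr (- \<alpha>)) / 2"
  proof -
    \<comment> \<open>The ratio of the two bases is at most 2, so its logarithm is at most 1 and its
      power -\<alpha> is at least 1 - \<alpha>. The kernel thus loses at most the fraction \<alpha>
      of its larger value over the cell.\<close>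
    let ?r = "(2 + \<sigma>) / (1 + \<sigma>)"
    have r: "1 \<le> ?r" "?r \<le> 2" using \<sigma> by (auto simp: divide_simps)
    have "ln ?r \<le> 1" using ln_le_minus_one[of ?r] r by simp
    then have "1 - \<alpha> \<le> 1 + (- \<alpha> * ln ?r)" using \<alpha> by (simp add: mult_left_le)
    also have "\<dots> \<le> exp (- \<alpha> * ln ?r)" by (rule exp_ge_add_one_self)
    also have "\<dots> = ?r powr (- \<alpha>)" using \<sigma> by (simp add: powr_def)
    finally have "1 - \<alpha> \<le> ?r powr (- \<alpha>)" .
    then have "(1 + \<sigma>) powr (- \<alpha>) * (1 - \<alpha>) \<le> (1 + \<sigma>) powr (- \<alpha>) * ?r powr (- \<alpha>)"
      by (intro mult_left_mono) auto
    also have "\<dots> = (2 + \<sigma>) powr (- \<alpha>)"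
      using \<sigma> by (simp flip: powr_mult)
    finally have "(1 + \<sigma>) powr (- \<alpha>) - (2 + \<sigma>) powr (- \<alpha>) \<le> \<alpha> * (1 + \<sigma>) powr (- \<alpha>)"
      by (simp add: algebra_simps)
    also have "\<dots> \<le> \<alpha> * \<sigma> powr (- \<alpha>)"
      using \<alpha> \<sigma> by (intro mult_left_mono powr_mono2') auto
    finally show ?thesis by simp
  qed
  finally show ?thesis using \<alpha> by (simp add: field_simps)
qed

end

section \<open>Monotonicity and size of the coefficients c\<close>

text \<open>For 0 < s < j, c is the sum of a - b at s and of b at s + 1, both decreasing in s. At s
  = j the nonnegative second summand is missing, which only lowers the value.\<close>

lemma coef_c_antimono:
  assumes \<alpha>: "0 < \<alpha>" "\<alpha> < 1" and \<sigma>: "0 < \<sigma>" and "1 \<le> s" "s < j"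
  shows "coef_c \<alpha> \<sigma> j (s + 1) \<le> coef_c \<alpha> \<sigma> j s"
proof (cases "s + 1 = j")
  case True
  then show ?thesis
    using coef_diff_antimono[of \<alpha> \<sigma> s] coef_b_nonneg[of \<alpha> \<sigma> "s + 1"] assms by (auto simp: coef_c_def)
next
  case False
  then show ?thesis
    using coef_diff_antimono[of \<alpha> \<sigma> s] coef_b_antimono[of \<alpha> \<sigma> "s + 1"] assms by (auto simp: coef_c_def)
qed

lemma coef_c_nonneg:
  assumes \<alpha>: "0 < \<alpha>" "\<alpha> < 1" and \<sigma>: "0 < \<sigma>" and "1 \<le> s" "s \<le> j"
  shows "0 \<le> coef_c \<alpha> \<sigma> j s"
proof -
  have "0 \<le> (1 - \<alpha>) * (real s + \<sigma>) powr (- \<alpha>)" using assms by simp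
  also have "\<dots> \<le> coef_a \<alpha> \<sigma> s - coef_b \<alpha> \<sigma> s" by (rule coef_diff_lower[OF assms(1-4)])
  finally show ?thesis using coef_b_nonneg[of \<alpha> \<sigma> "s + 1"] assms by (auto simp: coef_c_def)
qed

lemma coef_c_last_lower:
  assumes \<alpha>: "0 < \<alpha>" "\<alpha> < 1" and \<sigma>: "1 - \<alpha> \<le> \<sigma>"
  shows "(1 - \<alpha>) * (real j + \<sigma>) powr (- \<alpha>) \<le> coef_c \<alpha> \<sigma> j j"
proof (cases "j = 0")
  case True
  \<comment> \<open>For j = 0 the only coefficient is \<sigma> to the power 1 - \<alpha>, and the
    claim reduces to 1 - \<alpha> \<le> \<sigma>.\<close>
  have "(1 - \<alpha>) * \<sigma> powr (- \<alpha>) \<le> \<sigma> powr 1 * \<sigma> powr (- \<alpha>)"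
    using assms by (intro mult_right_mono) auto
  also have "\<dots> = \<sigma> powr (1 - \<alpha>)" unfolding powr_add[symmetric] by simp
  finally show ?thesis using True by (simp add: coef_c_def coef_a_def)
next
  case False
  then show ?thesis using coef_diff_lower[of \<alpha> \<sigma> j] assms by (auto simp: coef_c_def)
qed

text \<open>The bounds on a - b at 1 and on b at 2 leave the factor
  \<open>\<sigma> * (1 + \<alpha> / 2)\<close>, which equals 1 - \<alpha>^2 / 4 and so is at most 1.
  What remains is 1 - \<alpha> = 2\<sigma> - 1 times \<open>coef_a \<alpha> \<sigma> 0\<close>, a
  lower bound for c at 0.\<close>

lemma coef_c_first_two:
  assumes \<alpha>: "0 < \<alpha>" "\<alpha> < 1" and \<sigma>: "\<sigma> = 1 - \<alpha> / 2" and "1 \<le> j"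
  shows "\<sigma>\<^sup>2 * coef_c \<alpha> \<sigma> j 1 \<le> (2 * \<sigma> - 1) * coef_c \<alpha> \<sigma> j 0"
proof -
  have \<sigma>0: "0 < \<sigma>" using assms by simp
  have "coef_c \<alpha> \<sigma> j 1 \<le> coef_a \<alpha> \<sigma> 1 - coef_b \<alpha> \<sigma> 1 + coef_b \<alpha> \<sigma> 2"
    using assms coef_b_nonneg[of \<alpha> \<sigma> 2] \<sigma>0 by (auto simp: coef_c_def numeral_2_eq_2)
  also have "\<dots> \<le> (1 - \<alpha>) * \<sigma> powr (- \<alpha>) + (1 - \<alpha>) * (\<alpha> / 2 * \<sigma> powr (- \<alpha>))"
    using coef_diff_1_upper[of \<alpha> \<sigma>] coef_b_2_upper[of \<alpha> \<sigma>] \<alpha> \<sigma>0 by simp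
  also have "\<dots> = (1 - \<alpha>) * \<sigma> powr (- \<alpha>) * (1 + \<alpha> / 2)"
    by (simp add: distrib_left)
  finally have "\<sigma>\<^sup>2 * coef_c \<alpha> \<sigma> j 1 \<le> \<sigma>\<^sup>2 * ((1 - \<alpha>) * \<sigma> powr (- \<alpha>) * (1 + \<alpha> / 2))"
    by (intro mult_left_mono) auto
  also have "\<dots> = (1 - \<alpha>) * (\<sigma> * \<sigma> powr (- \<alpha>)) * (\<sigma> * (1 + \<alpha> / 2))"
    by (simp only: power2_eq_square mult_ac)
  also have "\<dots> \<le> (1 - \<alpha>) * (\<sigma> * \<sigma> powr (- \<alpha>)) * 1"
  proof (rule mult_left_mono)
    show "\<sigma> * (1 + \<alpha> / 2) \<le> 1" unfolding \<sigma> by (simp add: algebra_simps)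
  qed (use \<alpha> \<sigma>0 in auto)
  also have "\<dots> = (1 - \<alpha>) * coef_a \<alpha> \<sigma> 0"
    using powr_add[of \<sigma> 1 "- \<alpha>"] \<sigma>0 by (simp add: coef_a_def)
  also have "\<dots> \<le> (1 - \<alpha>) * coef_c \<alpha> \<sigma> j 0"
    using coef_b_nonneg[of \<alpha> \<sigma> 1] \<alpha> \<sigma>0 by (intro mult_left_mono) (auto simp: coef_c_def)
  finally show ?thesis using \<sigma> by simp
qed

lemma coef_c_antimono_0:
  assumes \<alpha>: "0 < \<alpha>" "\<alpha> < 1" and \<sigma>: "\<sigma> = 1 - \<alpha> / 2" and "1 \<le> j"
  shows "coef_c \<alpha> \<sigma> j 1 \<le> coef_c \<alpha> \<sigma> j 0"
proof -
  have "(2 * \<sigma> - 1) * coef_c \<alpha> \<sigma> j 1 \<le> \<sigma>\<^sup>2 * coef_c \<alpha> \<sigma> j 1"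
  proof (rule mult_right_mono)
    show "2 * \<sigma> - 1 \<le> \<sigma>\<^sup>2" using zero_le_power2[of "1 - \<sigma>"] by (simp add: power2_eq_square algebra_simps)
  qed (use coef_c_nonneg[of \<alpha> \<sigma> 1 j] assms in auto)
  also note coef_c_first_two[OF assms]
  finally show ?thesis using \<alpha> \<sigma> by simp
qed

section \<open>Truncation error in time\<close>

text \<open>Product integration: replacing \<open>w\<close> by \<open>p\<close> costs at most the
  uniform error times the mass of the kernel. The integral of \<open>w * K\<close> exists because a
  bounded measurable factor preserves absolute integrability of the nonnegative, possibly singular
  \<open>K\<close>.\<close>

lemma has_integral_mult_kernel_approx:
  fixes w p K :: "real \<Rightarrow> real"
  assumes w: "continuous_on {A..R} w" and K: "(K has_integral k) {A..R}"
    and K0: "\<And>x. x \<in> {A..R} \<Longrightarrow> 0 \<le> K x"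
    and p: "((\<lambda>x. p x * K x) has_integral L) {A..R}"
    and close: "\<And>x. x \<in> {A..R} \<Longrightarrow> \<bar>w x - p x\<bar> \<le> \<epsilon>"
  shows "\<exists>I. ((\<lambda>x. w x * K x) has_integral I) {A..R} \<and> \<bar>I - L\<bar> \<le> \<epsilon> * k"
proof -
  have "K absolutely_integrable_on {A..R}"
    using K K0 by (intro nonnegative_absolutely_integrable_1) (auto simp: has_integral_iff)
  then have "(\<lambda>x. w x * K x) absolutely_integrable_on {A..R}"
    using w by (intro absolutely_integrable_bounded_measurable_product_real
        continuous_imp_measurable_on_sets_lebesgue compact_imp_bounded compact_continuous_image) auto
  then obtain I where I: "((\<lambda>x. w x * K x) has_integral I) {A..R}"
    using absolutely_integrable_on_def integrable_on_def by metis
  have D: "((\<lambda>x. w x * K x - p x * K x) has_integral I - L) {A..R}"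
    by (rule has_integral_diff[OF I p])
  have E: "((\<lambda>x. \<epsilon> * K x) has_integral \<epsilon> * k) {A..R}"
    by (rule has_integral_mult_right[OF K])
  have b: "\<bar>w x * K x - p x * K x\<bar> \<le> \<epsilon> * K x" if "x \<in> {A..R}" for x
    using mult_right_mono[OF close[OF that] K0[OF that]] K0[OF that]
    by (simp add: abs_mult flip: left_diff_distrib)
  have "I - L \<le> \<epsilon> * k" by (rule has_integral_le[OF D E]) (use b in \<open>force simp: abs_le_iff\<close>)
  moreover have "- (I - L) \<le> \<epsilon> * k"
    by (rule has_integral_le[OF has_integral_neg[OF D] E]) (use b in \<open>force simp: abs_le_iff\<close>)
  ultimately show ?thesis using I by (auto simp: abs_le_iff)
qed

section \<open>Taylor estimates for difference quotients on a cell\<close>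

lemma taylor_within:
  fixes G :: "nat \<Rightarrow> real \<Rightarrow> real"
  assumes "\<And>i x. x \<in> {a..b} \<Longrightarrow> i \<le> n \<Longrightarrow> (G i has_real_derivative G (Suc i) x) (at x within {a..b})"
    and "\<And>x. x \<in> {a..b} \<Longrightarrow> \<bar>G (Suc n) x\<bar> \<le> B" and "w \<in> {a..b}" "z \<in> {a..b}"
  shows "\<bar>G 0 z - (\<Sum>i\<le>n. G i w * (z - w) ^ i / fact i)\<bar> \<le> B * \<bar>z - w\<bar> ^ Suc n / fact n"
  using field_Taylor[of "{a..b}" n G B w z] assms by simp

text \<open>Everything is expanded at the midpoint \<open>m\<close> of the cell. The second estimate
  concerns the derivative of the quadratic interpolant at A, A + \<tau> and A + 2\<tau>: it takes
  the value \<open>\<delta> A\<close> at \<open>m\<close> and has slope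
  \<open>(\<delta> (A + \<tau>) - \<delta> A) / \<tau>\<close>. The first one serves the last cell,
  where no third node is available.\<close>

lemma slope_approx:
  fixes G :: "nat \<Rightarrow> real \<Rightarrow> real"
  assumes der: "\<And>i x. x \<in> {0..T} \<Longrightarrow> i \<le> 2 \<Longrightarrow> (G i has_real_derivative G (Suc i) x) (at x within {0..T})"
    and B: "\<And>x. x \<in> {0..T} \<Longrightarrow> \<bar>G 3 x\<bar> \<le> B"
    and A: "0 \<le> A" "0 < \<tau>" "A + \<tau> \<le> T"
  defines "m \<equiv> A + \<tau> / 2" and "\<delta> \<equiv> \<lambda>s. (G 0 (s + \<tau>) - G 0 s) / \<tau>"
  shows linear_derivative_approx:
      "\<eta> \<in> {A..A + \<tau>} \<Longrightarrow> \<bar>G 1 \<eta> - (\<delta> A + G 2 m * (\<eta> - m))\<bar> \<le> 2 * B * \<tau>\<^sup>2"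
    and quadratic_derivative_approx:
      "A + 2 * \<tau> \<le> T \<Longrightarrow> \<eta> \<in> {A..A + \<tau>} \<Longrightarrow>
        \<bar>G 1 \<eta> - (\<delta> A + (\<delta> (A + \<tau>) - \<delta> A) / \<tau> * (\<eta> - m))\<bar> \<le> 2 * B * \<tau>\<^sup>2"
proof -
  have m: "m \<in> {0..T}" using A by (auto simp: m_def)
  have B0: "0 \<le> B" using B[OF m] by simp
  have tay: "\<bar>G 0 z - (G 0 m + G 1 m * (z - m) + G 2 m * (z - m)\<^sup>2 / 2)\<bar> \<le> B * \<bar>z - m\<bar> ^ 3 / 2"
    if "z \<in> {0..T}" for z
    using taylor_within[of 0 T 2 G B m z] der B m that
    by (simp add: numeral_eq_Suc algebra_simps)
  have "\<bar>G 0 A - (G 0 m - G 1 m * (\<tau> / 2) + G 2 m * \<tau>\<^sup>2 / 8)\<bar> \<le> B * \<tau> ^ 3 / 16"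
    using tay[of A] A unfolding m_def by (simp add: field_simps power2_eq_square power3_eq_cube)
  moreover have "\<bar>G 0 (A + \<tau>) - (G 0 m + G 1 m * (\<tau> / 2) + G 2 m * \<tau>\<^sup>2 / 8)\<bar> \<le> B * \<tau> ^ 3 / 16"
    using tay[of "A + \<tau>"] A unfolding m_def by (simp add: field_simps power2_eq_square power3_eq_cube)
  \<comment> \<open>Both ends are equally far from \<open>m\<close>, so the second-order terms
    cancel in the difference.\<close>
  ultimately have e01: "\<bar>(G 0 (A + \<tau>) - G 0 A) - G 1 m * \<tau>\<bar> \<le> B * \<tau> ^ 3 / 8"
    and e1: "\<bar>G 0 (A + \<tau>) - (G 0 m + G 1 m * (\<tau> / 2) + G 2 m * \<tau>\<^sup>2 / 8)\<bar> \<le> B * \<tau> ^ 3 / 16"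
    by linarith+
  have "\<delta> A - G 1 m = ((G 0 (A + \<tau>) - G 0 A) - G 1 m * \<tau>) / \<tau>"
    using A by (simp add: \<delta>_def field_simps)
  also have "\<bar>\<dots>\<bar> \<le> B * \<tau> ^ 3 / 8 / \<tau>"
    unfolding abs_divide using divide_right_mono[OF e01, of \<tau>] A by simp
  finally have s: "\<bar>\<delta> A - G 1 m\<bar> \<le> B * \<tau>\<^sup>2 / 8"
    using A by (simp add: power2_eq_square power3_eq_cube)
  have d: "\<bar>G 1 \<eta> - (G 1 m + G 2 m * (\<eta> - m))\<bar> \<le> B * \<tau>\<^sup>2 / 4" if \<eta>: "\<eta> \<in> {A..A + \<tau>}" for \<eta>
  proof -
    have "\<bar>G 1 \<eta> - (G 1 m + G 2 m * (\<eta> - m))\<bar> \<le> B * \<bar>\<eta> - m\<bar>\<^sup>2"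
      using taylor_within[of 0 T 1 "\<lambda>i. G (Suc i)" B m \<eta>] der B m \<eta> A
      by (simp add: numeral_eq_Suc)
    also have "\<dots> \<le> B * (\<tau> / 2)\<^sup>2"
      using B0 \<eta> by (intro mult_left_mono power_mono) (auto simp: m_def abs_if field_simps)
    finally show ?thesis by (simp add: power2_eq_square)
  qed
  have small: "0 \<le> B * \<tau>\<^sup>2" using B0 by simp
  show "\<bar>G 1 \<eta> - (\<delta> A + G 2 m * (\<eta> - m))\<bar> \<le> 2 * B * \<tau>\<^sup>2" if "\<eta> \<in> {A..A + \<tau>}"
    using d[OF that] s small by linarith
  show "\<bar>G 1 \<eta> - (\<delta> A + (\<delta> (A + \<tau>) - \<delta> A) / \<tau> * (\<eta> - m))\<bar> \<le> 2 * B * \<tau>\<^sup>2"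
    if A2: "A + 2 * \<tau> \<le> T" and \<eta>: "\<eta> \<in> {A..A + \<tau>}"
  proof -
    have z: "A + \<tau> + \<tau> - m = 3 * \<tau> / 2" by (simp add: m_def)
    have "A + \<tau> + \<tau> \<in> {0..T}" using A A2 by simp
    from tay[OF this] have "\<bar>G 0 (A + \<tau> + \<tau>) - (G 0 m + G 1 m * (3 * \<tau> / 2) + G 2 m * (3 * \<tau> / 2)\<^sup>2 / 2)\<bar> \<le> B * \<bar>3 * \<tau> / 2\<bar> ^ 3 / 2"
      unfolding z .
    then have e2: "\<bar>G 0 (A + \<tau> + \<tau>) - (G 0 m + G 1 m * (3 * \<tau> / 2) + G 2 m * (9 * \<tau>\<^sup>2 / 8))\<bar> \<le> 27 * (B * \<tau> ^ 3) / 16"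
      using A by (simp add: field_simps power2_eq_square power3_eq_cube)
    \<comment> \<open>The second difference is \<open>e2\<close> minus \<open>e1\<close> minus
      \<open>e01\<close>: first-order terms cancel, and 27/16 + 1/16 + 1/8 = 15/8.\<close>
    have e3: "\<bar>(G 0 (A + \<tau> + \<tau>) - G 0 (A + \<tau>)) - (G 0 (A + \<tau>) - G 0 A) - G 2 m * \<tau>\<^sup>2\<bar> \<le> 15 * (B * \<tau> ^ 3) / 8"
      using e2 e1 e01 by linarith
    have "(\<delta> (A + \<tau>) - \<delta> A) / \<tau> - G 2 m =
        ((G 0 (A + \<tau> + \<tau>) - G 0 (A + \<tau>)) - (G 0 (A + \<tau>) - G 0 A) - G 2 m * \<tau>\<^sup>2) / \<tau>\<^sup>2"
      using A by (simp add: \<delta>_def field_simps power2_eq_square)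
    also have "\<bar>\<dots>\<bar> \<le> 15 * (B * \<tau> ^ 3) / 8 / \<tau>\<^sup>2"
      using divide_right_mono[OF e3, of "\<tau>\<^sup>2"] by (simp only: abs_divide abs_power2 zero_le_power2)
    also have "\<dots> = 15 / 8 * (B * \<tau>)" using A by (simp add: power2_eq_square power3_eq_cube)
    finally have "\<bar>(\<delta> (A + \<tau>) - \<delta> A) / \<tau> - G 2 m\<bar> \<le> 15 / 8 * (B * \<tau>)" .
    moreover have "\<bar>\<eta> - m\<bar> \<le> \<tau> / 2" using \<eta> by (auto simp: m_def abs_if field_simps)
    ultimately have "\<bar>(\<delta> (A + \<tau>) - \<delta> A) / \<tau> - G 2 m\<bar> * \<bar>\<eta> - m\<bar> \<le> 15 / 8 * (B * \<tau>) * (\<tau> / 2)"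
      using B0 A by (intro mult_mono) auto
    then have "\<bar>(\<delta> (A + \<tau>) - \<delta> A) / \<tau> * (\<eta> - m) - G 2 m * (\<eta> - m)\<bar> \<le> 15 / 16 * (B * \<tau>\<^sup>2)"
      unfolding abs_mult[symmetric] left_diff_distrib by (simp add: power2_eq_square mult.assoc)
    then show ?thesis using d[OF \<eta>] s small by linarith
  qed
qed

section \<open>Exact integration over the time cells and the truncation error\<close>

text \<open>Scaling by \<tau> reduces a time cell to the unit cell. \<open>P\<close> is the distance
  from the left end of the cell to the singularity at (j + \<sigma>)\<tau>, measured in units of
  \<tau>.\<close>

lemma kernel_cell_has_integral:
  fixes \<alpha> \<tau> \<sigma> :: real
  assumes "\<alpha> < 1" "0 < \<sigma>" "0 < \<tau>" "s < j"
  shows "((\<lambda>\<eta>. ((real j + \<sigma>) * \<tau> - \<eta>) powr (- \<alpha>)) has_integral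
      \<tau> powr (1 - \<alpha>) / (1 - \<alpha>) * coef_a \<alpha> \<sigma> (j - s)) {real s * \<tau>..real (s + 1) * \<tau>}" (is ?A)
    and "((\<lambda>\<eta>. (\<eta> - (real s * \<tau> + \<tau> / 2)) * ((real j + \<sigma>) * \<tau> - \<eta>) powr (- \<alpha>)) has_integral
      \<tau> powr (1 - \<alpha>) / (1 - \<alpha>) * (\<tau> * coef_b \<alpha> \<sigma> (j - s))) {real s * \<tau>..real (s + 1) * \<tau>}" (is ?B)
proof -
  define P where "P = real (j - s) + \<sigma>"
  have P: "P > 1" "real (j - s) - 1 + \<sigma> = P - 1" and js: "j - s \<noteq> 0"
    using assms by (auto simp: P_def)
  have A: "(real j + \<sigma>) * \<tau> - real s * \<tau> = \<tau> * P" and R: "(real j + \<sigma>) * \<tau> - real (s + 1) * \<tau> = \<tau> * (P - 1)"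
    using assms by (auto simp: P_def of_nat_diff algebra_simps)
  have le: "real s * \<tau> \<le> real (s + 1) * \<tau>" "real (s + 1) * \<tau> \<le> (real j + \<sigma>) * \<tau>"
    using assms by (auto intro!: mult_right_mono)
  have pw: "(\<tau> * x) powr y = \<tau> powr y * x powr y" if "x \<ge> 0" for x y using assms that by (simp add: powr_mult)
  have t2: "\<tau> powr (2 - \<alpha>) = \<tau> * \<tau> powr (1 - \<alpha>)"
    using powr_add[of \<tau> 1 "1 - \<alpha>"] assms by simp
  have P0: "P \<ge> 0" "P - 1 \<ge> 0" using P by auto
  have "coef_a \<alpha> \<sigma> (j - s) = P powr (1 - \<alpha>) - (P - 1) powr (1 - \<alpha>)"
    using js unfolding coef_a_def P(2) P_def[symmetric] by simp
  then show ?A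
    using powr_kernel_has_integral[OF assms(1) le] unfolding A R pw[OF P0(1)] pw[OF P0(2)]
    by (simp add: right_diff_distrib diff_divide_distrib)
  have alg: "(- (\<tau> / 2) * (t * q1) / (1 - \<alpha>) - \<tau> * t * q2 / ((1 - \<alpha>) * (2 - \<alpha>)))
      - (- (- \<tau> / 2) * (t * p1) / (1 - \<alpha>) - \<tau> * t * p2 / ((1 - \<alpha>) * (2 - \<alpha>)))
    = t / (1 - \<alpha>) * (\<tau> * (1 / (2 - \<alpha>) * (p2 - q2) - 1 / 2 * (p1 + q1)))" for t p1 p2 q1 q2 :: real
    using assms by (simp add: divide_simps) (simp add: algebra_simps)
  have c: "real (s + 1) * \<tau> - (real s * \<tau> + \<tau> / 2) = \<tau> / 2" "real s * \<tau> - (real s * \<tau> + \<tau> / 2) = - \<tau> / 2"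
    by (auto simp: algebra_simps)
  show ?B
    using powr_kernel_moment_has_integral[OF assms(1) le, of "real s * \<tau> + \<tau> / 2"]
    unfolding A R c pw[OF P0(1)] pw[OF P0(2)] t2 alg coef_b_def P(2) P_def[symmetric] .
qed

text \<open>The choice \<open>\<sigma> = 1 - \<alpha> / 2\<close> makes the first moment of the kernel over the last, incomplete cell vanish.\<close>

lemma kernel_last_cell_has_integral:
  fixes \<alpha> \<tau> \<sigma> :: real
  assumes "\<alpha> < 1" "0 < \<alpha>" "0 < \<tau>" "\<sigma> = 1 - \<alpha> / 2"
  shows "((\<lambda>\<eta>. ((real j + \<sigma>) * \<tau> - \<eta>) powr (- \<alpha>)) has_integral
      \<tau> powr (1 - \<alpha>) / (1 - \<alpha>) * coef_a \<alpha> \<sigma> 0) {real j * \<tau>..(real j + \<sigma>) * \<tau>}" (is ?A)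
    and "((\<lambda>\<eta>. (\<eta> - (real j * \<tau> + \<tau> / 2)) * ((real j + \<sigma>) * \<tau> - \<eta>) powr (- \<alpha>)) has_integral 0)
      {real j * \<tau>..(real j + \<sigma>) * \<tau>}" (is ?B)
proof -
  have \<sigma>: "\<sigma> > 0" using assms by simp
  have A: "(real j + \<sigma>) * \<tau> - real j * \<tau> = \<tau> * \<sigma>"
    by (auto simp: algebra_simps)
  have le: "real j * \<tau> \<le> (real j + \<sigma>) * \<tau>" "(real j + \<sigma>) * \<tau> \<le> (real j + \<sigma>) * \<tau>"
    using assms \<sigma> by (auto intro!: mult_right_mono)
  have pw: "(\<tau> * \<sigma>) powr y = \<tau> powr y * \<sigma> powr y" for y using assms \<sigma> by (simp add: powr_mult)
  have t2: "x powr (2 - \<alpha>) = x * x powr (1 - \<alpha>)" if "x > 0" for x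
    using powr_add[of x 1 "1 - \<alpha>"] that by simp
  show ?A
    using powr_kernel_has_integral[OF assms(1) le] assms(1) unfolding A pw
    by (simp add: coef_a_def)
  have "0 - (- (- \<tau> / 2) * q / (1 - \<alpha>) - \<tau> * \<sigma> * q / ((1 - \<alpha>) * (2 - \<alpha>))) = 0" for q :: real
    using assms(1,2) unfolding assms(4) by (simp add: divide_simps)
  then show ?B
    using powr_kernel_moment_has_integral[OF assms(1) le, of "real j * \<tau> + \<tau> / 2"] assms(1) t2[of "\<tau> * \<sigma>"] assms(3) \<sigma>
    unfolding A by (simp add: mult.assoc)
qed

text \<open>This is the form in which cellwise integration delivers the sum. Each slope receives a -
  b from its own cell and b from the cell before it; collecting by slopes gives c, with exceptions
  at both ends because the first cell has no predecessor and the last one carries no quadratic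
  correction.\<close>

lemma disc_frac_conv_coef_a_b:
  "disc_frac \<alpha> \<sigma> \<tau> j w = \<tau> powr (1 - \<alpha>) / Gamma (2 - \<alpha>) *
    ((\<Sum>s<j. coef_a \<alpha> \<sigma> (j - s) * ((w (s + 1) - w s) / \<tau>)
       + coef_b \<alpha> \<sigma> (j - s) * ((w (s + 2) - w (s + 1)) / \<tau> - (w (s + 1) - w s) / \<tau>))
     + coef_a \<alpha> \<sigma> 0 * ((w (j + 1) - w j) / \<tau>))"
proof -
  define \<delta> where "\<delta> s = (w (s + 1) - w s) / \<tau>" for s
  have *: "(\<Sum>s = 0..j. coef_c \<alpha> \<sigma> j (j - s) * \<delta> s) =
    (\<Sum>s<j. coef_a \<alpha> \<sigma> (j - s) * \<delta> s + coef_b \<alpha> \<sigma> (j - s) * (\<delta> (s + 1) - \<delta> s)) + coef_a \<alpha> \<sigma> 0 * \<delta> j"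
  proof (cases j)
    case 0
    then show ?thesis by (simp add: coef_c_def)
  next
    case (Suc i)
    have "(\<Sum>s = 0..j. coef_c \<alpha> \<sigma> j (j - s) * \<delta> s)
      = (\<Sum>s\<le>j. coef_a \<alpha> \<sigma> (j - s) * \<delta> s - (if s < j then coef_b \<alpha> \<sigma> (j - s) * \<delta> s else 0)
          + (if s = 0 then 0 else coef_b \<alpha> \<sigma> (j - s + 1) * \<delta> s))"
      unfolding atLeast0AtMost using Suc
      by (intro sum.cong) (auto simp: coef_c_def algebra_simps)
    also have "\<dots> = (\<Sum>s\<le>j. coef_a \<alpha> \<sigma> (j - s) * \<delta> s) - (\<Sum>s\<le>j. if s < j then coef_b \<alpha> \<sigma> (j - s) * \<delta> s else 0)
        + (\<Sum>s\<le>j. if s = 0 then 0 else coef_b \<alpha> \<sigma> (j - s + 1) * \<delta> s)"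
      by (simp add: sum.distrib sum_subtractf)
    also have "(\<Sum>s\<le>j. if s < j then coef_b \<alpha> \<sigma> (j - s) * \<delta> s else 0) = (\<Sum>s<j. coef_b \<alpha> \<sigma> (j - s) * \<delta> s)"
      by (simp add: lessThan_Suc_atMost[symmetric])
    also have "(\<Sum>s\<le>j. if s = 0 then 0 else coef_b \<alpha> \<sigma> (j - s + 1) * \<delta> s) = (\<Sum>s<j. coef_b \<alpha> \<sigma> (j - s) * \<delta> (s + 1))"
      unfolding lessThan_Suc_atMost[symmetric] sum.lessThan_Suc_shift
      by (auto intro!: sum.cong simp: Suc_diff_Suc)
    also have "(\<Sum>s\<le>j. coef_a \<alpha> \<sigma> (j - s) * \<delta> s) = (\<Sum>s<j. coef_a \<alpha> \<sigma> (j - s) * \<delta> s) + coef_a \<alpha> \<sigma> 0 * \<delta> j"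
      by (simp add: lessThan_Suc_atMost[symmetric])
    finally show ?thesis by (simp add: algebra_simps sum.distrib sum_subtractf)
  qed
  show ?thesis unfolding disc_frac_def using * by (simp add: \<delta>_def)
qed

text \<open>On each cell the error is at most \<open>2 * B * \<tau>\<^sup>2\<close> times the mass
  of the kernel there. These masses add up to the mass over the whole interval, which is bounded in
  terms of T, so no power of \<tau> is lost to the number of cells.\<close>

lemma caputo_truncation:
  fixes G :: "nat \<Rightarrow> real \<Rightarrow> real"
  assumes \<alpha>: "0 < \<alpha>" "\<alpha> < 1" and \<sigma>: "\<sigma> = 1 - \<alpha> / 2" and \<tau>: "0 < \<tau>" "real (j + 1) * \<tau> \<le> T"
    and der: "\<And>i x. x \<in> {0..T} \<Longrightarrow> i \<le> 2 \<Longrightarrow> (G i has_real_derivative G (Suc i) x) (at x within {0..T})"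
    and B: "\<And>x. x \<in> {0..T} \<Longrightarrow> \<bar>G 3 x\<bar> \<le> B"
  shows "\<bar>1 / Gamma (1 - \<alpha>) * integral {0..(real j + \<sigma>) * \<tau>} (\<lambda>\<eta>. G 1 \<eta> * ((real j + \<sigma>) * \<tau> - \<eta>) powr (- \<alpha>))
      - disc_frac \<alpha> \<sigma> \<tau> j (\<lambda>s. G 0 (real s * \<tau>))\<bar>
    \<le> 2 * B * T powr (1 - \<alpha>) / Gamma (2 - \<alpha>) * \<tau>\<^sup>2"
proof -
  define \<theta> where "\<theta> = (real j + \<sigma>) * \<tau>"
  define K where "K \<eta> = (\<theta> - \<eta>) powr (- \<alpha>)" for \<eta>
  define \<delta> where "\<delta> s = (G 0 (real (s + 1) * \<tau>) - G 0 (real s * \<tau>)) / \<tau>" for s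
  define c where "c = \<tau> powr (1 - \<alpha>) / (1 - \<alpha>)"
  define \<Lambda> where "\<Lambda> s = c * (coef_a \<alpha> \<sigma> (j - s) * \<delta> s + coef_b \<alpha> \<sigma> (j - s) * (\<delta> (s + 1) - \<delta> s))" for s
  have \<sigma>0: "0 < \<sigma>" "\<sigma> < 1" using \<alpha> \<sigma> by auto
  have B0: "0 \<le> B" using B[of 0] \<tau> order_trans[of 0 "real (j + 1) * \<tau>" T] by auto
  have cont: "continuous_on {0..T} (G 1)"
    using der[of _ 1] by (intro DERIV_continuous_on) auto
  have jT: "real (s + 1) * \<tau> \<le> T" if "s \<le> j" for s
    using that \<tau> by (intro order_trans[OF mult_right_mono \<tau>(2)]) auto
  have \<theta>: "\<theta> \<le> T" "real j * \<tau> \<le> \<theta>"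
    unfolding \<theta>_def using \<tau> \<sigma>0 by (auto intro!: order_trans[OF mult_right_mono \<tau>(2)] mult_right_mono)
  have K0: "0 \<le> K \<eta>" for \<eta> by (simp add: K_def)
  have cells: "\<exists>I. ((\<lambda>\<eta>. G 1 \<eta> * K \<eta>) has_integral I) {0..real n * \<tau>} \<and>
      \<bar>I - (\<Sum>s<n. \<Lambda> s)\<bar> \<le> 2 * B * \<tau>\<^sup>2 * integral {0..real n * \<tau>} K" if "n \<le> j" for n
    using that
  proof (induction n)
    case 0
    then show ?case by (auto intro!: exI[of _ 0])
  next
    case (Suc n)
    then obtain I where I: "((\<lambda>\<eta>. G 1 \<eta> * K \<eta>) has_integral I) {0..real n * \<tau>}"
      "\<bar>I - (\<Sum>s<n. \<Lambda> s)\<bar> \<le> 2 * B * \<tau>\<^sup>2 * integral {0..real n * \<tau>} K" by auto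
    have nj: "n < j" using Suc by simp
    let ?A = "real n * \<tau>" and ?R = "real (n + 1) * \<tau>"
    have R: "?R = ?A + \<tau>" "real (n + 2) * \<tau> = ?A + \<tau> + \<tau>" by (auto simp: algebra_simps)
    \<comment> \<open>The quadratic interpolant also uses the node (n + 2)\<tau>, which stays within
      [0, T] because n < j.\<close>
    have AR: "0 \<le> ?A" "?A \<le> ?R" "?R \<le> T" "real (n + 2) * \<tau> \<le> T"
      using \<tau> jT[of n] jT[of "n + 1"] nj by (auto simp: mult_right_mono)
    have Kc: "(K has_integral c * coef_a \<alpha> \<sigma> (j - n)) {?A..?R}"
      using kernel_cell_has_integral(1)[of \<alpha> \<sigma> \<tau> n j] \<alpha> \<sigma>0 \<tau> nj by (simp add: K_def[abs_def] c_def \<theta>_def)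
    have Kb: "((\<lambda>\<eta>. (\<eta> - (?A + \<tau> / 2)) * K \<eta>) has_integral c * (\<tau> * coef_b \<alpha> \<sigma> (j - n))) {?A..?R}"
      using kernel_cell_has_integral(2)[of \<alpha> \<sigma> \<tau> n j] \<alpha> \<sigma>0 \<tau> nj by (simp add: K_def[abs_def] c_def \<theta>_def)
    let ?\<kappa> = "(\<delta> (n + 1) - \<delta> n) / \<tau>"
    have P: "((\<lambda>\<eta>. (\<delta> n + ?\<kappa> * (\<eta> - (?A + \<tau> / 2))) * K \<eta>) has_integral \<Lambda> n) {?A..?R}"
    proof -
      have eq: "\<delta> n * (c * coef_a \<alpha> \<sigma> (j - n)) + ?\<kappa> * (c * (\<tau> * coef_b \<alpha> \<sigma> (j - n))) = \<Lambda> n"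
        unfolding \<Lambda>_def using \<tau>(1) by (simp add: field_simps)
      show ?thesis
        using has_integral_add[OF has_integral_mult_right[OF Kc, of "\<delta> n"] has_integral_mult_right[OF Kb, of ?\<kappa>]]
        unfolding eq distrib_right mult.assoc .
    qed
    have close: "\<bar>G 1 \<eta> - (\<delta> n + ?\<kappa> * (\<eta> - (?A + \<tau> / 2)))\<bar> \<le> 2 * B * \<tau>\<^sup>2" if "\<eta> \<in> {?A..?R}" for \<eta>
    proof -
      have "\<delta> n = (G 0 (?A + \<tau>) - G 0 ?A) / \<tau>" "\<delta> (n + 1) = (G 0 (?A + \<tau> + \<tau>) - G 0 (?A + \<tau>)) / \<tau>"
        unfolding \<delta>_def R(1) R(2)[symmetric] by (simp_all add: algebra_simps)
      then show ?thesis
        using quadratic_derivative_approx[of T G B ?A \<tau> \<eta>] der B AR \<tau>(1) that unfolding R by simp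
    qed
    obtain J where J: "((\<lambda>\<eta>. G 1 \<eta> * K \<eta>) has_integral J) {?A..?R}"
      "\<bar>J - \<Lambda> n\<bar> \<le> 2 * B * \<tau>\<^sup>2 * (c * coef_a \<alpha> \<sigma> (j - n))"
      using has_integral_mult_kernel_approx[OF continuous_on_subset[OF cont] Kc K0 P close] AR by auto
    have "?A \<le> \<theta>" using nj \<tau> by (intro order_trans[OF mult_right_mono \<theta>(2)]) auto
    then have Kn: "(K has_integral integral {0..?A} K) {0..?A}"
      using powr_kernel_has_integral[of \<alpha> 0 ?A \<theta>] \<alpha> AR
      by (intro integrable_integral) (auto simp: K_def[abs_def] integrable_on_def)
    have "integral {0..?R} K = integral {0..?A} K + c * coef_a \<alpha> \<sigma> (j - n)"
      using has_integral_combine[OF AR(1,2) Kn Kc] by blast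
    then have "\<bar>I + J - (\<Sum>s<Suc n. \<Lambda> s)\<bar> \<le> 2 * B * \<tau>\<^sup>2 * integral {0..?R} K"
      using I(2) J(2) by (simp add: distrib_left)
    then show ?case using has_integral_combine[OF AR(1,2) I(1) J(1)] by auto
  qed
  obtain I where I: "((\<lambda>\<eta>. G 1 \<eta> * K \<eta>) has_integral I) {0..real j * \<tau>}"
      "\<bar>I - (\<Sum>s<j. \<Lambda> s)\<bar> \<le> 2 * B * \<tau>\<^sup>2 * integral {0..real j * \<tau>} K" using cells by blast
  let ?A = "real j * \<tau>"
  have R: "?A + \<tau> = real (j + 1) * \<tau>" by (simp add: algebra_simps)
  have Kc: "(K has_integral c * coef_a \<alpha> \<sigma> 0) {?A..\<theta>}"
    and Kb: "((\<lambda>\<eta>. (\<eta> - (?A + \<tau> / 2)) * K \<eta>) has_integral 0) {?A..\<theta>}"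
    using kernel_last_cell_has_integral[of \<alpha> \<tau> \<sigma> j] \<alpha> \<sigma> \<tau> by (simp_all add: K_def[abs_def] c_def \<theta>_def)
  \<comment> \<open>The constant slope \<open>\<delta> j\<close> alone is only first-order accurate.
    Adding the linear term with this slope gives second order, and it leaves the integral unchanged
    by \<open>Kb\<close>, since the first moment vanishes.\<close>
  let ?\<kappa> = "G 2 (?A + \<tau> / 2)"
  have P: "((\<lambda>\<eta>. (\<delta> j + ?\<kappa> * (\<eta> - (?A + \<tau> / 2))) * K \<eta>) has_integral c * (coef_a \<alpha> \<sigma> 0 * \<delta> j)) {?A..\<theta>}"
    using has_integral_add[OF has_integral_mult_right[OF Kc, of "\<delta> j"] has_integral_mult_right[OF Kb, of ?\<kappa>]]
    by (simp add: algebra_simps)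
  have \<theta>R: "\<theta> \<le> ?A + \<tau>" unfolding \<theta>_def R using \<tau> \<sigma>0 by (intro mult_right_mono) auto
  have close: "\<bar>G 1 \<eta> - (\<delta> j + ?\<kappa> * (\<eta> - (?A + \<tau> / 2)))\<bar> \<le> 2 * B * \<tau>\<^sup>2" if "\<eta> \<in> {?A..\<theta>}" for \<eta>
    using linear_derivative_approx[of T G B ?A \<tau> \<eta>] der B \<tau> that \<theta>R unfolding \<delta>_def R[symmetric] by simp
  obtain J where J: "((\<lambda>\<eta>. G 1 \<eta> * K \<eta>) has_integral J) {?A..\<theta>}"
    "\<bar>J - c * (coef_a \<alpha> \<sigma> 0 * \<delta> j)\<bar> \<le> 2 * B * \<tau>\<^sup>2 * (c * coef_a \<alpha> \<sigma> 0)"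
    using has_integral_mult_kernel_approx[OF continuous_on_subset[OF cont] Kc K0 P close] \<theta> \<tau> by auto
  have A0: "0 \<le> ?A" using \<tau> by simp
  have Kn: "(K has_integral integral {0..?A} K) {0..?A}"
    using powr_kernel_has_integral[of \<alpha> 0 ?A \<theta>] \<alpha> A0 \<theta>(2)
    by (intro integrable_integral) (auto simp: K_def[abs_def] integrable_on_def)
  have Kall: "(K has_integral \<theta> powr (1 - \<alpha>) / (1 - \<alpha>)) {0..\<theta>}"
    using powr_kernel_has_integral[of \<alpha> 0 \<theta> \<theta>] \<alpha> A0 \<theta>(2) by (simp add: K_def[abs_def])
  have IK: "integral {0..?A} K + c * coef_a \<alpha> \<sigma> 0 = \<theta> powr (1 - \<alpha>) / (1 - \<alpha>)"
    by (rule has_integral_unique[OF has_integral_combine[OF A0 \<theta>(2) Kn Kc] Kall])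
  have int: "integral {0..\<theta>} (\<lambda>\<eta>. G 1 \<eta> * K \<eta>) = I + J"
    by (rule integral_unique[OF has_integral_combine[OF A0 \<theta>(2) I(1) J(1)]])
  define S where "S = (\<Sum>s<j. \<Lambda> s) + c * (coef_a \<alpha> \<sigma> 0 * \<delta> j)"
  have G2: "Gamma (2 - \<alpha>) = (1 - \<alpha>) * Gamma (1 - \<alpha>)" and Gpos: "Gamma (1 - \<alpha>) > 0"
    using Gamma_plus1[of "1 - \<alpha>"] nonpos_Ints_nonpos[of "1 - \<alpha>"] \<alpha> by auto
  have "S = c * ((\<Sum>s<j. coef_a \<alpha> \<sigma> (j - s) * \<delta> s + coef_b \<alpha> \<sigma> (j - s) * (\<delta> (s + 1) - \<delta> s)) + coef_a \<alpha> \<sigma> 0 * \<delta> j)"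
    unfolding S_def \<Lambda>_def by (simp add: sum_distrib_left distrib_left)
  then have S: "disc_frac \<alpha> \<sigma> \<tau> j (\<lambda>s. G 0 (real s * \<tau>)) = 1 / Gamma (1 - \<alpha>) * S"
    unfolding disc_frac_conv_coef_a_b G2 \<delta>_def c_def using \<alpha> by (simp add: add.commute)
  have "\<bar>(I + J) - S\<bar> \<le> 2 * B * \<tau>\<^sup>2 * (integral {0..?A} K + c * coef_a \<alpha> \<sigma> 0)"
    using I(2) J(2) unfolding S_def by (simp add: distrib_left)
  also have "\<dots> \<le> 2 * B * \<tau>\<^sup>2 * (T powr (1 - \<alpha>) / (1 - \<alpha>))"
    unfolding IK using \<theta> A0 B0 \<alpha> by (intro mult_left_mono divide_right_mono powr_mono2) auto
  finally have "1 / Gamma (1 - \<alpha>) * \<bar>(I + J) - S\<bar> \<le> 1 / Gamma (1 - \<alpha>) * (2 * B * \<tau>\<^sup>2 * (T powr (1 - \<alpha>) / (1 - \<alpha>)))"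
    using Gpos by (intro mult_left_mono) auto
  also have "\<dots> = 2 * B * T powr (1 - \<alpha>) / Gamma (2 - \<alpha>) * \<tau>\<^sup>2" unfolding G2 by (simp add: mult_ac)
  also have "1 / Gamma (1 - \<alpha>) * \<bar>(I + J) - S\<bar> = \<bar>1 / Gamma (1 - \<alpha>) * (I + J) - 1 / Gamma (1 - \<alpha>) * S\<bar>"
    using Gpos by (simp add: abs_mult flip: right_diff_distrib diff_divide_distrib)
  finally show ?thesis using S int unfolding K_def[abs_def] \<theta>_def by simp
qed

section \<open>The compact difference operator\<close>

lemma Hh_conv: "h \<noteq> 0 \<Longrightarrow> Hh h v i = (v (i - 1) + 10 * v i + v (i + 1)) / 12"
  by (simp add: Hh_def sdiff_def field_simps)

text \<open>The operator is a convex combination with weights 1/12, 10/12 and 1/12.\<close>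

lemma Hh_abs_le:
  assumes "h \<noteq> 0" "\<bar>v (i - 1)\<bar> \<le> B" "\<bar>v i\<bar> \<le> B" "\<bar>v (i + 1)\<bar> \<le> B"
  shows "\<bar>Hh h v i\<bar> \<le> B"
  using assms by (simp add: Hh_conv)

lemma Hh_diff: "Hh h (\<lambda>m. v m - w m) i = Hh h v i - Hh h w i"
  by (simp add: Hh_def sdiff_def add_divide_distrib diff_divide_distrib algebra_simps)

lemma Hh_add: "Hh h (\<lambda>m. v m + w m) i = Hh h v i + Hh h w i"
  by (simp add: Hh_def sdiff_def add_divide_distrib diff_divide_distrib algebra_simps)

lemma Hh_cmult: "Hh h (\<lambda>m. c * v m) i = c * Hh h v i"
  by (simp add: Hh_def sdiff_def add_divide_distrib diff_divide_distrib algebra_simps)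

lemma sdiff_diff: "sdiff h (\<lambda>m. v m - w m) i = sdiff h v i - sdiff h w i"
  by (simp add: sdiff_def add_divide_distrib diff_divide_distrib algebra_simps)

lemma disc_frac_add: "disc_frac \<alpha> \<sigma> \<tau> j (\<lambda>s. v s + w s) = disc_frac \<alpha> \<sigma> \<tau> j v + disc_frac \<alpha> \<sigma> \<tau> j w"
proof -
  have "(x + y - (x' + y')) / \<tau> = (x - x') / \<tau> + (y - y') / \<tau>" for x y x' y'
    by (simp add: diff_divide_distrib add_divide_distrib)
  then show ?thesis by (simp only: disc_frac_def distrib_left sum.distrib)
qed

lemma disc_frac_cmult: "disc_frac \<alpha> \<sigma> \<tau> j (\<lambda>s. c * v s) = c * disc_frac \<alpha> \<sigma> \<tau> j v"
proof -
  have "(c * x - c * y) / \<tau> = c * ((x - y) / \<tau>)" for x y by (simp add: right_diff_distrib)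
  then show ?thesis
    by (simp only: disc_frac_def sum_distrib_left mult.left_commute mult.assoc)
qed

lemma disc_frac_diff: "disc_frac \<alpha> \<sigma> \<tau> j (\<lambda>s. v s - w s) = disc_frac \<alpha> \<sigma> \<tau> j v - disc_frac \<alpha> \<sigma> \<tau> j w"
  using disc_frac_add[of \<alpha> \<sigma> \<tau> j v "\<lambda>s. - 1 * w s"] unfolding disc_frac_cmult by simp

lemma disc_frac_Hh:
  assumes "h \<noteq> 0"
  shows "disc_frac \<alpha> \<sigma> \<tau> j (\<lambda>s. Hh h (v s) i) = Hh h (\<lambda>m. disc_frac \<alpha> \<sigma> \<tau> j (\<lambda>s. v s m)) i"
proof -
  have "disc_frac \<alpha> \<sigma> \<tau> j (\<lambda>s. Hh h (v s) i)
      = disc_frac \<alpha> \<sigma> \<tau> j (\<lambda>s. (1 / 12) * (v s (i - 1) + 10 * v s i + v s (i + 1)))"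
    using assms by (simp add: Hh_conv)
  then show ?thesis
    using assms by (simp only: disc_frac_cmult disc_frac_add) (simp add: Hh_conv)
qed

section \<open>Fourth order in space and second order of the time average\<close>

text \<open>The Numerov principle: the second difference of \<open>G 0\<close> and
  \<open>H_h\<close> applied to \<open>G 2\<close> share the leading part
  \<open>G 2 x + h\<^sup>2 / 12 * G 4 x\<close>, and odd orders cancel by symmetry. The remainders
  contribute at most 1/60 and 1/36 of \<open>B * h ^ 4\<close>.\<close>

lemma compact_difference_consistency:
  fixes G :: "nat \<Rightarrow> real \<Rightarrow> real"
  assumes h: "0 < h" and i: "1 \<le> i" "real (i + 1) * h \<le> l"
    and der: "\<And>k x. x \<in> {0..l} \<Longrightarrow> k \<le> 5 \<Longrightarrow> (G k has_real_derivative G (Suc k) x) (at x within {0..l})"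
    and B: "\<And>x. x \<in> {0..l} \<Longrightarrow> \<bar>G 6 x\<bar> \<le> B"
  shows "\<bar>sdiff h (\<lambda>m. G 0 (real m * h)) i - Hh h (\<lambda>m. G 2 (real m * h)) i\<bar> \<le> B * h ^ 4"
proof -
  define x where "x = real i * h"
  have x: "real (i + 1) * h = x + h" "real (i - 1) * h = x - h" "0 \<le> x - h"
    using i h by (auto simp: x_def algebra_simps of_nat_diff)
  have xl: "x \<in> {0..l}" "x + h \<in> {0..l}" "x - h \<in> {0..l}"
    using x i h by auto
  have B0: "0 \<le> B" using B[OF xl(1)] by simp
  have t6: "\<bar>G 0 z - (\<Sum>k\<le>5. G k x * (z - x) ^ k / fact k)\<bar> \<le> B * \<bar>z - x\<bar> ^ 6 / fact 5" if "z \<in> {0..l}" for z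
    using taylor_within[of 0 l 5 G B x z] der B xl that by simp
  have t4: "\<bar>G 2 z - (\<Sum>k\<le>3. G (k + 2) x * (z - x) ^ k / fact k)\<bar> \<le> B * \<bar>z - x\<bar> ^ 4 / fact 3" if "z \<in> {0..l}" for z
    using taylor_within[of 0 l 3 "\<lambda>k. G (k + 2)" B x z] der B xl that by (simp add: numeral_2_eq_2[symmetric])
  define e1 e2 where "e1 = G 0 (x + h) - (\<Sum>k\<le>5. G k x * h ^ k / fact k)"
    and "e2 = G 0 (x - h) - (\<Sum>k\<le>5. G k x * (- h) ^ k / fact k)"
  define f1 f2 where "f1 = G 2 (x + h) - (\<Sum>k\<le>3. G (k + 2) x * h ^ k / fact k)"
    and "f2 = G 2 (x - h) - (\<Sum>k\<le>3. G (k + 2) x * (- h) ^ k / fact k)"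
  have e: "\<bar>e1\<bar> \<le> B * h ^ 6 / 120" "\<bar>e2\<bar> \<le> B * h ^ 6 / 120"
    using t6[OF xl(2)] t6[OF xl(3)] h by (simp_all add: e1_def e2_def fact_numeral)
  have f: "\<bar>f1\<bar> \<le> B * h ^ 4 / 6" "\<bar>f2\<bar> \<le> B * h ^ 4 / 6"
    using t4[OF xl(2)] t4[OF xl(3)] h by (simp_all add: f1_def f2_def fact_numeral)
  have g0: "G 0 (x + h) - 2 * G 0 x + G 0 (x - h) = h\<^sup>2 * (G 2 x + h\<^sup>2 / 12 * G 4 x) + (e1 + e2)"
    unfolding e1_def e2_def by (simp add: numeral_eq_Suc fact_numeral field_simps)
  have "sdiff h (\<lambda>m. G 0 (real m * h)) i = (h\<^sup>2 * (G 2 x + h\<^sup>2 / 12 * G 4 x) + (e1 + e2)) / h\<^sup>2"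
    unfolding sdiff_def x x_def[symmetric] g0[symmetric] by simp
  also have "\<dots> = G 2 x + h\<^sup>2 / 12 * G 4 x + (e1 + e2) / h\<^sup>2"
    using h by (simp add: add_divide_distrib)
  finally have s: "sdiff h (\<lambda>m. G 0 (real m * h)) i = G 2 x + h\<^sup>2 / 12 * G 4 x + (e1 + e2) / h\<^sup>2" .
  have g2: "G 2 (x + h) + G 2 (x - h) = 2 * G 2 x + h\<^sup>2 * G 4 x + (f1 + f2)"
    unfolding f1_def f2_def by (simp add: numeral_eq_Suc fact_numeral field_simps)
  have "Hh h (\<lambda>m. G 2 (real m * h)) i = (G 2 (x + h) + G 2 (x - h) + 10 * G 2 x) / 12"
    using h unfolding Hh_conv[OF less_imp_neq[OF h, symmetric]] x x_def[symmetric] by simp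
  also have "\<dots> = G 2 x + h\<^sup>2 / 12 * G 4 x + (f1 + f2) / 12"
    unfolding g2 by (simp add: field_simps)
  finally have t: "Hh h (\<lambda>m. G 2 (real m * h)) i = G 2 x + h\<^sup>2 / 12 * G 4 x + (f1 + f2) / 12" .
  have "\<bar>e1 + e2\<bar> \<le> B * h ^ 6 / 60" using e by linarith
  then have "\<bar>(e1 + e2) / h\<^sup>2\<bar> \<le> B * h ^ 6 / 60 / h\<^sup>2"
    by (simp only: abs_divide abs_power2) (rule divide_right_mono, auto)
  also have "\<dots> = B * h ^ 4 / 60" using h by (simp add: power_diff_power_eq numeral_eq_Suc)
  finally have "\<bar>(e1 + e2) / h\<^sup>2\<bar> \<le> B * h ^ 4 / 60" .
  moreover have "\<bar>f1 + f2\<bar> \<le> B * h ^ 4 / 3" using f by linarith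
  then have "\<bar>(f1 + f2) / 12\<bar> \<le> B * h ^ 4 / 36" unfolding abs_divide by simp
  moreover have "0 \<le> B * h ^ 4" using B0 by simp
  ultimately show ?thesis unfolding s t by linarith
qed

text \<open>Expansion at the intermediate point: its distances to the two ends are (1 -
  \<sigma>)\<tau> and \<sigma>\<tau>, so the first-order terms cancel under the weights \<sigma> and
  1 - \<sigma>.\<close>

lemma weighted_average_approx:
  fixes G :: "nat \<Rightarrow> real \<Rightarrow> real"
  assumes \<tau>: "0 < \<tau>" "0 \<le> A" "A + \<tau> \<le> T" and \<sigma>: "0 \<le> \<sigma>" "\<sigma> \<le> 1"
    and der: "\<And>k x. x \<in> {0..T} \<Longrightarrow> k \<le> 1 \<Longrightarrow> (G k has_real_derivative G (Suc k) x) (at x within {0..T})"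
    and B: "\<And>x. x \<in> {0..T} \<Longrightarrow> \<bar>G 2 x\<bar> \<le> B"
  shows "\<bar>\<sigma> * G 0 (A + \<tau>) + (1 - \<sigma>) * G 0 A - G 0 (A + \<sigma> * \<tau>)\<bar> \<le> B * \<tau>\<^sup>2"
proof -
  let ?w = "A + \<sigma> * \<tau>"
  have st: "0 \<le> \<sigma> * \<tau>" "\<sigma> * \<tau> \<le> \<tau>" using \<tau> \<sigma> by (auto simp: mult_left_le_one_le)
  have w: "?w \<in> {0..T}" "A + \<tau> \<in> {0..T}" "A \<in> {0..T}"
    unfolding atLeastAtMost_iff using st \<tau> by (intro conjI; linarith)+
  have B0: "0 \<le> B" using B[OF w(1)] by simp
  have tay: "\<bar>G 0 z - (G 0 ?w + G 1 ?w * (z - ?w))\<bar> \<le> B * \<tau>\<^sup>2" if z: "z \<in> {0..T}" "\<bar>z - ?w\<bar> \<le> \<tau>" for z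
  proof -
    have "\<bar>G 0 z - (G 0 ?w + G 1 ?w * (z - ?w))\<bar> \<le> B * \<bar>z - ?w\<bar>\<^sup>2"
      using taylor_within[of 0 T 1 G B ?w z] der B w z(1) by (simp add: numeral_eq_Suc)
    also have "\<dots> \<le> B * \<tau>\<^sup>2" using B0 z(2) by (intro mult_left_mono power_mono) auto
    finally show ?thesis .
  qed
  define r1 r0 where "r1 = G 0 (A + \<tau>) - (G 0 ?w + G 1 ?w * (A + \<tau> - ?w))"
    and "r0 = G 0 A - (G 0 ?w + G 1 ?w * (A - ?w))"
  have dist: "\<bar>A + \<tau> - ?w\<bar> \<le> \<tau>" "\<bar>A - ?w\<bar> \<le> \<tau>" using st by linarith+
  have r: "\<bar>r1\<bar> \<le> B * \<tau>\<^sup>2" "\<bar>r0\<bar> \<le> B * \<tau>\<^sup>2"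
    unfolding r1_def r0_def by (rule tay[OF w(2) dist(1)], rule tay[OF w(3) dist(2)])
  have "\<sigma> * G 0 (A + \<tau>) + (1 - \<sigma>) * G 0 A - G 0 ?w = \<sigma> * r1 + (1 - \<sigma>) * r0"
    unfolding r1_def r0_def by (simp add: algebra_simps)
  also have "\<bar>\<dots>\<bar> \<le> \<sigma> * \<bar>r1\<bar> + (1 - \<sigma>) * \<bar>r0\<bar>"
    using \<sigma> by (intro order_trans[OF abs_triangle_ineq]) (simp add: abs_mult)
  also have "\<dots> \<le> \<sigma> * (B * \<tau>\<^sup>2) + (1 - \<sigma>) * (B * \<tau>\<^sup>2)"
    using r \<sigma> by (intro add_mono mult_left_mono) auto
  finally show ?thesis by (simp add: algebra_simps)
qed

section \<open>Stability\<close>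

lemma abel_summation:
  fixes g e :: "nat \<Rightarrow> real"
  shows "(\<Sum>s\<le>n. g s * (e s - e (s + 1)))
    = g 0 * e 0 + (\<Sum>s<n. (g (s + 1) - g s) * e (s + 1)) - g n * e (n + 1)"
  by (induction n) (auto simp: algebra_simps)

text \<open>
  With \<open>D\<^sub>s = V\<^sub>j\<^sub>+\<^sub>1 - V\<^sub>s\<close>, the difference of the two sides is \<open>\<Sum> g\<^sub>s (e\<^sub>s - e\<^sub>s\<^sub>+\<^sub>1)\<close> for
  \<open>e\<^sub>s = D\<^sub>s\<^sup>2 / 2 - (1 - \<sigma>) D\<^sub>j D\<^sub>s\<close>; summation by parts and \<open>e\<^sub>s \<ge> - (1 - \<sigma>)\<^sup>2 D\<^sub>j\<^sup>2 / 2\<close> conclude.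
\<close>

lemma alikhanov_inequality:
  fixes g V :: "nat \<Rightarrow> real"
  assumes mono: "\<And>s. s < j \<Longrightarrow> g s \<le> g (s + 1)" and g0: "0 \<le> g 0" and \<sigma>: "1 / 2 \<le> \<sigma>"
    and top: "1 \<le> j \<Longrightarrow> \<sigma>\<^sup>2 * g (j - 1) \<le> (2 * \<sigma> - 1) * g j"
  shows "1 / 2 * (\<Sum>s\<le>j. g s * ((V (s + 1))\<^sup>2 - (V s)\<^sup>2))
    \<le> (\<Sum>s\<le>j. g s * (V (s + 1) - V s)) * (\<sigma> * V (j + 1) + (1 - \<sigma>) * V j)"
proof -
  define D where "D s = V (j + 1) - V s" for s
  define e where "e s = (D s)\<^sup>2 / 2 - (1 - \<sigma>) * D j * D s" for s
  have e_lower: "- ((1 - \<sigma>)\<^sup>2 * (D j)\<^sup>2 / 2) \<le> e s" for s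
  proof -
    have "- (c\<^sup>2 * y\<^sup>2 / 2) \<le> x\<^sup>2 / 2 - c * y * x" for c x y :: real
      using zero_le_power2[of "x - c * y"] by (simp add: power2_diff power_mult_distrib mult_ac)
    then show ?thesis unfolding e_def .
  qed
  have ej: "e j = (2 * \<sigma> - 1) * (D j)\<^sup>2 / 2" unfolding e_def by (simp add: power2_eq_square algebra_simps)
  have e_end: "e (j + 1) = 0" by (simp add: e_def D_def)
  have "(\<Sum>s\<le>j. g s * (V (s + 1) - V s)) * (\<sigma> * V (j + 1) + (1 - \<sigma>) * V j)
      - 1 / 2 * (\<Sum>s\<le>j. g s * ((V (s + 1))\<^sup>2 - (V s)\<^sup>2))
    = (\<Sum>s\<le>j. g s * (e s - e (s + 1)))"
    unfolding sum_distrib_left sum_distrib_right sum_subtractf[symmetric]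
  proof (intro sum.cong refl)
    fix s
    have "(V (s + 1) - V s) * (\<sigma> * V (j + 1) + (1 - \<sigma>) * V j) - 1 / 2 * ((V (s + 1))\<^sup>2 - (V s)\<^sup>2)
        = e s - e (s + 1)"
      unfolding e_def D_def by (simp add: power2_eq_square field_simps)
    moreover have "a * x * y - b * (a * w) = a * (x * y - b * w)" for a b w x y :: real
      by (simp add: algebra_simps)
    ultimately show "g s * (V (s + 1) - V s) * (\<sigma> * V (j + 1) + (1 - \<sigma>) * V j)
        - 1 / 2 * (g s * ((V (s + 1))\<^sup>2 - (V s)\<^sup>2)) = g s * (e s - e (s + 1))"
      by (simp only:)
  qed
  also have "\<dots> = g 0 * e 0 + (\<Sum>s<j. (g (s + 1) - g s) * e (s + 1))"
    unfolding abel_summation e_end by simp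
  also have "\<dots> \<ge> 0"
  proof (cases j)
    case 0
    moreover have "0 \<le> e j" unfolding ej using \<sigma> by (intro divide_nonneg_nonneg mult_nonneg_nonneg) auto
    ultimately show ?thesis using g0 by simp
  next
    case (Suc i)
    \<comment> \<open>Only \<open>e j\<close> keeps its exact value. All earlier terms are replaced
      by \<open>?E\<close>, and their weights telescope to \<open>g i\<close>. Since (1 -
      \<sigma>)^2 + (2\<sigma> - 1) = \<sigma>^2, the sign of the result is exactly what
      \<open>top\<close> controls.\<close>
    let ?E = "- ((1 - \<sigma>)\<^sup>2 * (D j)\<^sup>2 / 2)"
    have "(\<Sum>s<i. (g (s + 1) - g s) * ?E) = (g i - g 0) * ?E"
      using sum_lessThan_telescope[of g i] by (simp only: sum_distrib_right[symmetric] Suc_eq_plus1)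
    then have "g i * ?E = g 0 * ?E + (\<Sum>s<i. (g (s + 1) - g s) * ?E)"
      by (simp only: left_diff_distrib)
    also have "\<dots> \<le> g 0 * e 0 + (\<Sum>s<i. (g (s + 1) - g s) * e (s + 1))"
      using g0 mono Suc by (intro add_mono sum_mono mult_left_mono e_lower) auto
    finally have "g i * ?E + (g j - g i) * e j \<le> g 0 * e 0 + (\<Sum>s<j. (g (s + 1) - g s) * e (s + 1))"
      using Suc by simp
    moreover have "g i * ?E + (g j - g i) * e j = ((2 * \<sigma> - 1) * g j - \<sigma>\<^sup>2 * g i) * (D j)\<^sup>2 / 2"
      unfolding ej by (simp add: power2_eq_square field_simps)
    moreover have "\<dots> \<ge> 0" using top Suc by simp
    ultimately show ?thesis by linarith
  qed
  finally show ?thesis by simp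
qed

section \<open>Discrete Green, inverse and Poincare inequalities\<close>

lemma sum_by_parts_second_difference:
  fixes z :: "nat \<Rightarrow> real"
  shows "(\<Sum>i = 1..n. (z (i + 1) - 2 * z i + z (i - 1)) * z i)
    = (z (n + 1) - z n) * z (n + 1) - (z 1 - z 0) * z 0 - (\<Sum>i\<le>n. (z (i + 1) - z i)\<^sup>2)"
  by (induction n) (auto simp: power2_eq_square algebra_simps)

text \<open>Each first difference enters two second differences, each time with factor 2. The last
  one has so far entered only one; the subtracted term records this and closes the
  induction.\<close>

lemma sum_second_difference_sq_le:
  fixes z :: "nat \<Rightarrow> real"
  shows "(\<Sum>i = 1..n. (z (i + 1) - 2 * z i + z (i - 1))\<^sup>2)
    \<le> 4 * (\<Sum>i\<le>n. (z (i + 1) - z i)\<^sup>2) - 2 * (z (n + 1) - z n)\<^sup>2"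
proof (induction n)
  case (Suc n)
  have "(z (n + 2) - 2 * z (n + 1) + z n)\<^sup>2 \<le> 2 * (z (n + 2) - z (n + 1))\<^sup>2 + 2 * (z (n + 1) - z n)\<^sup>2"
    using zero_le_power2[of "z (n + 2) - z n"] by (simp add: power2_eq_square algebra_simps)
  then show ?case using Suc by simp
qed simp

lemma sum_difference_sq_le:
  fixes z :: "nat \<Rightarrow> real"
  shows "(\<Sum>i\<le>n. (z (i + 1) - z i)\<^sup>2) \<le> 2 * (z 0)\<^sup>2 + 4 * (\<Sum>i = 1..n. (z i)\<^sup>2) + 2 * (z (n + 1))\<^sup>2"
proof (induction n)
  case 0
  show ?case using zero_le_power2[of "z 1 + z 0"] by (simp add: power2_eq_square algebra_simps)
next
  case (Suc n)
  have "(z (n + 2) - z (n + 1))\<^sup>2 \<le> 2 * (z (n + 2))\<^sup>2 + 2 * (z (n + 1))\<^sup>2"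
    using zero_le_power2[of "z (n + 2) + z (n + 1)"] by (simp add: power2_eq_square algebra_simps)
  then show ?case using Suc by simp
qed

context
  fixes z :: "nat \<Rightarrow> real" and h :: real and N :: nat
  assumes h: "0 < h" and N: "1 \<le> N" and z0: "z 0 = 0" and zN: "z N = 0"
begin

lemma sum_second_difference_mult:
  "(\<Sum>i = 1..N - 1. (z (i + 1) - 2 * z i + z (i - 1)) * z i) = - (\<Sum>i<N. (z (i + 1) - z i)\<^sup>2)"
  using sum_by_parts_second_difference[of z "N - 1"] N z0 zN by (simp add: lessThan_Suc_atMost[symmetric])

text \<open>Summation by parts contributes -1 times the sum of squared differences, and the
  correction in \<open>H_h\<close> at most 4/12 of it, which leaves the factor -2/3.\<close>

lemma sum_sdiff_Hh_le:
  "(\<Sum>i = 1..N - 1. sdiff h z i * Hh h z i) \<le> - (2 / 3) * ((\<Sum>i<N. (z (i + 1) - z i)\<^sup>2) / h\<^sup>2)"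
proof -
  let ?D = "\<lambda>i. z (i + 1) - 2 * z i + z (i - 1)" and ?S = "\<Sum>i<N. (z (i + 1) - z i)\<^sup>2"
  have "(\<Sum>i = 1..N - 1. (?D i)\<^sup>2) \<le> 4 * ?S - 2 * (z N - z (N - 1))\<^sup>2"
    using sum_second_difference_sq_le[of z "N - 1"] N by (simp add: lessThan_Suc_atMost[symmetric])
  then have D2: "(\<Sum>i = 1..N - 1. (?D i)\<^sup>2) \<le> 4 * ?S"
    using zero_le_power2[of "z N - z (N - 1)"] by linarith
  have "(\<Sum>i = 1..N - 1. sdiff h z i * Hh h z i) = (\<Sum>i = 1..N - 1. (?D i * z i + (?D i)\<^sup>2 / 12) / h\<^sup>2)"
    using h by (intro sum.cong) (auto simp: sdiff_def Hh_def power2_eq_square field_simps)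
  also have "\<dots> = ((\<Sum>i = 1..N - 1. ?D i * z i) + (\<Sum>i = 1..N - 1. (?D i)\<^sup>2) / 12) / h\<^sup>2"
    by (simp add: sum.distrib sum_divide_distrib add_divide_distrib)
  also have "\<dots> \<le> (- (2 / 3) * ?S) / h\<^sup>2"
    using D2 unfolding sum_second_difference_mult by (intro divide_right_mono) auto
  finally show ?thesis by simp
qed

text \<open>Since \<open>z 0 = 0\<close>, every grid value is a telescoping sum of at most N
  differences, to which Cauchy-Schwarz applies; averaging by \<open>H_h\<close> preserves the
  resulting uniform bound.\<close>

lemma Hh_sq_le:
  assumes "i \<in> {1..N - 1}"
  shows "(Hh h z i)\<^sup>2 \<le> real N * (\<Sum>i<N. (z (i + 1) - z i)\<^sup>2)"
proof -
  let ?S = "\<Sum>i<N. (z (i + 1) - z i)\<^sup>2"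
  have S0: "0 \<le> ?S" by (intro sum_nonneg) auto
  have z: "\<bar>z m\<bar> \<le> sqrt (real N * ?S)" if "m \<le> N" for m
  proof -
    have "(z m)\<^sup>2 = (\<Sum>i<m. z (i + 1) - z i)\<^sup>2" using sum_lessThan_telescope[of z m] z0 by simp
    also have "\<dots> \<le> (\<Sum>i<m. (z (i + 1) - z i)\<^sup>2) * real m"
      using sum_squared_le_sum_of_squares[of "\<lambda>i. z (i + 1) - z i" "{..<m}"] by simp
    also have "\<dots> \<le> ?S * real N"
      using that S0 by (intro mult_mono sum_mono2) (auto intro: sum_nonneg)
    finally show ?thesis using real_le_rsqrt[of "\<bar>z m\<bar>" "real N * ?S"] by (simp add: mult.commute)
  qed
  have "\<bar>Hh h z i\<bar> \<le> sqrt (real N * ?S)"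
    using assms h N by (intro Hh_abs_le z) auto
  from power_mono[OF this abs_ge_zero, of 2] show ?thesis using S0 by simp
qed

lemma sum_Hh_sq_le:
  "(\<Sum>i = 1..N - 1. (Hh h z i)\<^sup>2) \<le> (real N)\<^sup>2 * (\<Sum>i<N. (z (i + 1) - z i)\<^sup>2)"
proof -
  let ?S = "\<Sum>i<N. (z (i + 1) - z i)\<^sup>2"
  have "(\<Sum>i = 1..N - 1. (Hh h z i)\<^sup>2) \<le> (\<Sum>i = 1..N - 1. real N * ?S)"
    by (intro sum_mono Hh_sq_le)
  also have "\<dots> = real (N - 1) * (real N * ?S)" by simp
  also have "\<dots> \<le> real N * (real N * ?S)"
    by (intro mult_right_mono mult_nonneg_nonneg sum_nonneg) auto
  finally show ?thesis by (simp add: power2_eq_square)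
qed

text \<open>The inverse inequality bounds the inner product of z and \<open>H_h\<close> z from below
  by 2/3 of the squared norm of z. Young's inequality with weights 1/3 and 3/4 then leaves 1/3 on
  the left, hence the factor 9/4.\<close>

lemma sum_sq_le_sum_Hh_sq: "(\<Sum>i = 1..N - 1. (z i)\<^sup>2) \<le> 9 / 4 * (\<Sum>i = 1..N - 1. (Hh h z i)\<^sup>2)"
proof -
  let ?S = "\<Sum>i<N. (z (i + 1) - z i)\<^sup>2" and ?Z = "\<Sum>i = 1..N - 1. (z i)\<^sup>2"
  have "?S \<le> 4 * ?Z"
    using sum_difference_sq_le[of z "N - 1"] N z0 zN by (simp add: lessThan_Suc_atMost[symmetric])
  moreover have "(\<Sum>i = 1..N - 1. z i * Hh h z i) = ?Z - ?S / 12"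
  proof -
    have "(\<Sum>i = 1..N - 1. z i * Hh h z i)
        = (\<Sum>i = 1..N - 1. (z i)\<^sup>2 + ((z (i + 1) - 2 * z i + z (i - 1)) * z i) / 12)"
      using h by (intro sum.cong) (auto simp: Hh_def sdiff_def power2_eq_square field_simps)
    then show ?thesis
      unfolding sum.distrib sum_divide_distrib[symmetric] sum_second_difference_mult by simp
  qed
  moreover have "(\<Sum>i = 1..N - 1. z i * Hh h z i) \<le> (\<Sum>i = 1..N - 1. 1 / 3 * (z i)\<^sup>2 + 3 / 4 * (Hh h z i)\<^sup>2)"
  proof (rule sum_mono)
    fix i
    show "z i * Hh h z i \<le> 1 / 3 * (z i)\<^sup>2 + 3 / 4 * (Hh h z i)\<^sup>2"
      using zero_le_power2[of "2 * z i - 3 * Hh h z i"] by (simp add: power2_eq_square algebra_simps)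
  qed
  ultimately show ?thesis unfolding sum.distrib sum_distrib_left[symmetric] by linarith
qed

end

section \<open>Comparison argument and a priori estimate\<close>

text \<open>Summation by parts expresses \<open>g j * E (j + 1)\<close> through earlier values with
  nonnegative weights, apart from the term with \<open>E 0\<close>, which is at most 0. Bounding the
  earlier values and the source by \<open>b\<close>, the weights telescope to
  \<open>g j\<close>.\<close>

lemma discrete_fractional_comparison:
  fixes g E :: "nat \<Rightarrow> real"
  assumes mono: "\<And>s. s < j \<Longrightarrow> g s \<le> g (s + 1)" and g0: "0 < g 0"
    and sum: "(\<Sum>s\<le>j. g s * (E (s + 1) - E s)) \<le> g 0 * b"
    and E0: "E 0 \<le> 0" and E: "\<And>s. 1 \<le> s \<Longrightarrow> s \<le> j \<Longrightarrow> E s \<le> b"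
  shows "E (j + 1) \<le> b"
proof -
  have gj: "0 < g j" if "\<And>s. s < j \<Longrightarrow> g s \<le> g (s + 1)" for j
    using that by (induction j) (use g0 in \<open>auto intro: less_le_trans\<close>)
  have "(\<Sum>s\<le>j. g s * (E (s + 1) - E s)) = (\<Sum>s\<le>j. g s * (- E s - - E (s + 1)))" by simp
  also have "\<dots> = g j * E (j + 1) - g 0 * E 0 - (\<Sum>s<j. (g (s + 1) - g s) * E (s + 1))"
    unfolding abel_summation[of g "\<lambda>s. - E s"] by (simp add: sum_negf)
  finally have "g j * E (j + 1) \<le> g 0 * b + g 0 * E 0 + (\<Sum>s<j. (g (s + 1) - g s) * E (s + 1))"
    using sum by simp
  also have "\<dots> \<le> g 0 * b + 0 + (\<Sum>s<j. (g (s + 1) - g s) * b)"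
    using mono g0 E0 E by (intro add_mono sum_mono mult_left_mono order_refl) (auto simp: mult_le_0_iff)
  also have "\<dots> = g j * b"
    unfolding sum_distrib_right[symmetric] using sum_lessThan_telescope[of g j] by (simp add: left_diff_distrib)
  finally show ?thesis using gj[of j] mono by simp
qed

lemma compact_scheme_stability:
  fixes z \<psi> :: "nat \<Rightarrow> nat \<Rightarrow> real" and a d :: "nat \<Rightarrow> real"
  assumes \<alpha>: "0 < \<alpha>" "\<alpha> < 1" and pos: "0 < l" "0 < T" "0 < c" and NM: "1 \<le> N" "1 \<le> M"
    and h: "h = l / real N" and \<tau>: "\<tau> = T / real M" and \<sigma>: "\<sigma> = 1 - \<alpha> / 2"
    and a: "\<And>j. j < M \<Longrightarrow> c \<le> a j" and d: "\<And>j. j < M \<Longrightarrow> 0 \<le> d j"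
    and scheme: "\<And>i j. i \<in> {1..N - 1} \<Longrightarrow> j < M \<Longrightarrow>
      disc_frac \<alpha> \<sigma> \<tau> j (\<lambda>s. Hh h (z s) i)
        = a j * sdiff h (\<lambda>m. \<sigma> * z (j + 1) m + (1 - \<sigma>) * z j m) i
          - d j * Hh h (\<lambda>m. \<sigma> * z (j + 1) m + (1 - \<sigma>) * z j m) i + \<psi> j i"
    and boundary: "\<And>j. j \<le> M \<Longrightarrow> z j 0 = 0" "\<And>j. j \<le> M \<Longrightarrow> z j N = 0"
    and initial: "\<And>i. i \<le> N \<Longrightarrow> z 0 i = 0"
    and \<psi>: "\<And>i j. i \<in> {1..N - 1} \<Longrightarrow> j < M \<Longrightarrow> \<bar>\<psi> j i\<bar> \<le> \<Psi>" and \<Psi>: "0 \<le> \<Psi>"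
    and j: "j \<le> M"
  shows "norm0 h N (z j) \<le> sqrt (27 * l ^ 3 * Gamma (2 - \<alpha>) * T powr \<alpha> / (16 * c * (1 - \<alpha>))) * \<Psi>"
proof -
  define E where "E s = (\<Sum>i = 1..N - 1. (Hh h (z s) i)\<^sup>2)" for s
  \<comment> \<open>The energy step leaves the source
    \<open>3 * l\<^sup>2 / (4 * c) * (real N * \<Psi>\<^sup>2)\<close>, and \<open>b\<close> is this
    divided by a lower bound of \<open>P * g 0\<close> that is uniform in j. The factor N appears
    because \<open>E\<close> is summed without the mesh weight h.\<close>
  define b where "b = 3 * l\<^sup>2 * Gamma (2 - \<alpha>) * T powr \<alpha> / (4 * c * (1 - \<alpha>)) * (real N * \<Psi>\<^sup>2)"
  have h0: "0 < h" and hN: "real N * h = l" using h pos NM by auto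
  have \<tau>0: "0 < \<tau>" and \<tau>M: "real M * \<tau> = T" using \<tau> pos NM by auto
  have \<sigma>b: "1 / 2 \<le> \<sigma>" "0 < \<sigma>" "\<sigma> \<le> 1" "1 - \<alpha> \<le> \<sigma>" using \<alpha> \<sigma> by auto
  have Gpos: "0 < Gamma (2 - \<alpha>)" using \<alpha> by simp
  have b0: "0 \<le> b" unfolding b_def using pos \<alpha> Gpos by (intro mult_nonneg_nonneg divide_nonneg_nonneg) auto
  have E0: "E 0 = 0" unfolding E_def using initial h0 by (intro sum.neutral) (auto simp: Hh_conv)
  have step: "E (j + 1) \<le> b" if jM: "j < M" and IH: "\<And>s. 1 \<le> s \<Longrightarrow> s \<le> j \<Longrightarrow> E s \<le> b" for j
  proof -
    \<comment> \<open>Reversing the index makes the weights increase with the time level, so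
      \<open>g 0\<close> is the smallest one.\<close>
    define g where "g s = coef_c \<alpha> \<sigma> j (j - s)" for s
    define P where "P = \<tau> powr (1 - \<alpha>) / Gamma (2 - \<alpha>) / \<tau>"
    define z' where "z' m = \<sigma> * z (j + 1) m + (1 - \<sigma>) * z j m" for m
    have P: "P = \<tau> powr (- \<alpha>) / Gamma (2 - \<alpha>)" "0 < P"
      using \<tau>0 Gpos powr_add[of \<tau> 1 "- \<alpha>"] by (auto simp: P_def)
    have df: "disc_frac \<alpha> \<sigma> \<tau> j w = P * (\<Sum>s\<le>j. g s * (w (s + 1) - w s))" for w
      unfolding disc_frac_def P_def g_def atLeast0AtMost
      by (simp add: sum_distrib_left mult.assoc sum_divide_distrib)
    have mono: "g s \<le> g (s + 1)" if "s < j" for s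
    proof (cases "s + 1 = j")
      case True
      then show ?thesis using coef_c_antimono_0[of \<alpha> \<sigma> j] \<alpha> \<sigma> by (auto simp: g_def)
    next
      case False
      then show ?thesis
        using coef_c_antimono[of \<alpha> \<sigma> "j - (s + 1)" j] \<alpha> \<sigma>b that by (simp add: g_def Suc_diff_Suc)
    qed
    have g0: "(1 - \<alpha>) * (real j + \<sigma>) powr (- \<alpha>) \<le> g 0"
      using coef_c_last_lower[of \<alpha> \<sigma> j] \<alpha> \<sigma>b by (simp add: g_def)
    then have g0pos: "0 < g 0" using \<alpha> \<sigma>b by (intro less_le_trans[OF _ g0]) simp
    have top: "\<sigma>\<^sup>2 * g (j - 1) \<le> (2 * \<sigma> - 1) * g j" if "1 \<le> j"
      using coef_c_first_two[OF \<alpha> \<sigma> that] that by (simp add: g_def)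
    have z': "z' 0 = 0" "z' N = 0" using boundary[of j] boundary[of "j + 1"] jM by (auto simp: z'_def)
    have Hz': "Hh h z' i = \<sigma> * Hh h (z (j + 1)) i + (1 - \<sigma>) * Hh h (z j) i" for i
      unfolding z'_def by (simp add: Hh_add Hh_cmult)
    define S where "S = (\<Sum>i<N. (z' (i + 1) - z' i)\<^sup>2) / h\<^sup>2"
    have S0: "0 \<le> S" unfolding S_def by (intro divide_nonneg_nonneg sum_nonneg) auto
    have H2: "(\<Sum>i = 1..N - 1. (Hh h z' i)\<^sup>2) \<le> l\<^sup>2 * S"
      using sum_Hh_sq_le[of h N z'] h0 NM z' hN[symmetric] by (simp add: S_def power_mult_distrib)
    have cs: "a j * (\<Sum>i = 1..N - 1. sdiff h z' i * Hh h z' i) \<le> - (2 / 3 * c * S)"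
    proof -
      have "a j * (\<Sum>i = 1..N - 1. sdiff h z' i * Hh h z' i) \<le> a j * (- (2 / 3) * S)"
        using sum_sdiff_Hh_le[of h N z'] h0 NM z' a[OF jM] pos by (intro mult_left_mono) (auto simp: S_def)
      also have "\<dots> = - (2 / 3 * a j * S)" by simp
      also have "\<dots> \<le> - (2 / 3 * c * S)" using mult_right_mono[OF a[OF jM] S0] by (simp add: mult_ac)
      finally show ?thesis .
    qed
    \<comment> \<open>The weight \<open>2 * c / (3 * l\<^sup>2)\<close> is chosen so that, after the
      Poincare inequality \<open>H2\<close>, its contribution is exactly cancelled by the diffusion
      term \<open>cs\<close>.\<close>
    have young: "\<psi> j i * Hh h z' i \<le> 3 * l\<^sup>2 / (8 * c) * \<Psi>\<^sup>2 + 2 * c / (3 * l\<^sup>2) * (Hh h z' i)\<^sup>2"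
      if "i \<in> {1..N - 1}" for i
    proof -
      have y: "x * y \<le> 3 * l\<^sup>2 / (8 * c) * x\<^sup>2 + 2 * c / (3 * l\<^sup>2) * y\<^sup>2" for x y :: real
      proof -
        have "3 * l\<^sup>2 / (8 * c) * x\<^sup>2 + 2 * c / (3 * l\<^sup>2) * y\<^sup>2 - x * y
          = (3 * l\<^sup>2 * x - 4 * c * y)\<^sup>2 / (24 * c * l\<^sup>2)"
          using pos by (simp add: power2_eq_square field_simps)
        moreover have "0 \<le> (3 * l\<^sup>2 * x - 4 * c * y)\<^sup>2 / (24 * c * l\<^sup>2)" using pos by simp
        ultimately show ?thesis by linarith
      qed
      have "(\<psi> j i)\<^sup>2 \<le> \<Psi>\<^sup>2" using power_mono[OF \<psi>[OF that jM], of 2] by simp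
      then have "3 * l\<^sup>2 / (8 * c) * (\<psi> j i)\<^sup>2 \<le> 3 * l\<^sup>2 / (8 * c) * \<Psi>\<^sup>2"
        using pos by (intro mult_left_mono) auto
      then show ?thesis using y[of "\<psi> j i" "Hh h z' i"] by linarith
    qed
    have "P * (1 / 2 * (\<Sum>s\<le>j. g s * (E (s + 1) - E s)))
        = (\<Sum>i = 1..N - 1. P * (1 / 2 * (\<Sum>s\<le>j. g s * ((Hh h (z (s + 1)) i)\<^sup>2 - (Hh h (z s) i)\<^sup>2))))"
      unfolding E_def sum_subtractf[symmetric] sum_distrib_left by (rule sum.swap)
    also have "\<dots> \<le> (\<Sum>i = 1..N - 1. disc_frac \<alpha> \<sigma> \<tau> j (\<lambda>s. Hh h (z s) i) * Hh h z' i)"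
    proof (rule sum_mono)
      fix i
      show "P * (1 / 2 * (\<Sum>s\<le>j. g s * ((Hh h (z (s + 1)) i)\<^sup>2 - (Hh h (z s) i)\<^sup>2)))
          \<le> disc_frac \<alpha> \<sigma> \<tau> j (\<lambda>s. Hh h (z s) i) * Hh h z' i"
        unfolding df Hz' mult.assoc[of P]
        using alikhanov_inequality[of j g \<sigma> "\<lambda>s. Hh h (z s) i"] mono g0pos \<sigma>b top P
        by (intro mult_left_mono) auto
    qed
    also have "\<dots> = (\<Sum>i = 1..N - 1. a j * (sdiff h z' i * Hh h z' i) - d j * (Hh h z' i)\<^sup>2 + \<psi> j i * Hh h z' i)"
    proof (intro sum.cong refl)
      fix i assume "i \<in> {1..N - 1}"
      from scheme[OF this jM, folded z'_def]
      show "disc_frac \<alpha> \<sigma> \<tau> j (\<lambda>s. Hh h (z s) i) * Hh h z' i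
          = a j * (sdiff h z' i * Hh h z' i) - d j * (Hh h z' i)\<^sup>2 + \<psi> j i * Hh h z' i"
        by (simp only: power2_eq_square left_diff_distrib distrib_right mult.assoc)
    qed
    also have "\<dots> = a j * (\<Sum>i = 1..N - 1. sdiff h z' i * Hh h z' i) - d j * (\<Sum>i = 1..N - 1. (Hh h z' i)\<^sup>2)
        + (\<Sum>i = 1..N - 1. \<psi> j i * Hh h z' i)"
      by (simp add: sum.distrib sum_subtractf sum_distrib_left)
    also have "\<dots> \<le> - (2 / 3 * c * S) - 0 + (\<Sum>i = 1..N - 1. 3 * l\<^sup>2 / (8 * c) * \<Psi>\<^sup>2 + 2 * c / (3 * l\<^sup>2) * (Hh h z' i)\<^sup>2)"
      using cs young d[OF jM] by (intro add_mono diff_mono sum_mono) (auto intro!: mult_nonneg_nonneg sum_nonneg)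
    also have "\<dots> = - (2 / 3 * c * S) + real (N - 1) * (3 * l\<^sup>2 / (8 * c) * \<Psi>\<^sup>2)
        + 2 * c / (3 * l\<^sup>2) * (\<Sum>i = 1..N - 1. (Hh h z' i)\<^sup>2)"
      by (simp add: sum.distrib sum_distrib_left)
    also have "\<dots> \<le> - (2 / 3 * c * S) + real N * (3 * l\<^sup>2 / (8 * c) * \<Psi>\<^sup>2) + 2 * c / (3 * l\<^sup>2) * (l\<^sup>2 * S)"
      using pos H2 by (intro add_mono mult_left_mono mult_right_mono) auto
    also have "\<dots> = real N * (3 * l\<^sup>2 / (8 * c) * \<Psi>\<^sup>2)"
      using pos by simp
    finally have "P * (\<Sum>s\<le>j. g s * (E (s + 1) - E s)) \<le> 3 * l\<^sup>2 / (4 * c) * (real N * \<Psi>\<^sup>2)" by (simp add: mult_ac)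
    also have "\<dots> \<le> P * (g 0 * b)"
    proof -
      \<comment> \<open>The decay of \<open>g 0\<close> in j is harmless: j + \<sigma> \<le> M, and
        the scaling of \<open>P\<close> in \<tau> turns the power of M into a power of T.\<close>
      have "(1 - \<alpha>) * \<tau> powr \<alpha> = (1 - \<alpha>) * (real M) powr (- \<alpha>) * T powr \<alpha>"
        using NM \<tau>0 unfolding \<tau>M[symmetric] by (simp add: powr_mult powr_minus)
      also have "\<dots> \<le> (1 - \<alpha>) * (real j + \<sigma>) powr (- \<alpha>) * T powr \<alpha>"
        using \<alpha> \<sigma>b jM by (intro mult_right_mono mult_left_mono powr_mono2') auto
      also have "\<dots> \<le> g 0 * T powr \<alpha>" using g0 by (intro mult_right_mono) auto
      finally have "1 \<le> g 0 * T powr \<alpha> * \<tau> powr (- \<alpha>) / (1 - \<alpha>)"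
        using \<alpha> \<tau>0 by (simp add: powr_minus field_simps)
      then have "3 * l\<^sup>2 / (4 * c) * (real N * \<Psi>\<^sup>2) * 1 \<le> 3 * l\<^sup>2 / (4 * c) * (real N * \<Psi>\<^sup>2) * (g 0 * T powr \<alpha> * \<tau> powr (- \<alpha>) / (1 - \<alpha>))"
        using pos by (intro mult_left_mono) auto
      also have "\<dots> = P * (g 0 * b)"
        unfolding P(1) b_def using Gpos by simp
      finally show ?thesis by simp
    qed
    finally have "(\<Sum>s\<le>j. g s * (E (s + 1) - E s)) \<le> g 0 * b" using P(2) by simp
    then show ?thesis
      using discrete_fractional_comparison[of j g E b] mono g0pos E0 IH by auto
  qed
  have "E s \<le> b" if "s \<le> M" for s
    using that
  proof (induction s rule: less_induct)
    case (less s)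
    show ?case
    proof (cases s)
      case 0
      then show ?thesis using E0 b0 by simp
    next
      case (Suc r)
      then show ?thesis using step[of r] less by auto
    qed
  qed
  then have Ej: "E j \<le> b" using j .
  have "(\<Sum>i = 1..N - 1. (z j i)\<^sup>2 * h) = (\<Sum>i = 1..N - 1. (z j i)\<^sup>2) * h"
    by (simp add: sum_distrib_right)
  also have "\<dots> \<le> 9 / 4 * E j * h"
    unfolding E_def using sum_sq_le_sum_Hh_sq[of h N "z j"] h0 NM boundary[OF j]
    by (intro mult_right_mono) auto
  also have "\<dots> \<le> 9 / 4 * b * h" using Ej h0 by (intro mult_right_mono mult_left_mono) auto
  \<comment> \<open>The mesh weight h absorbs the factor N of \<open>b\<close> through N h = l, so
    the constant is independent of the mesh.\<close>
  also have "\<dots> = 27 * l ^ 3 * Gamma (2 - \<alpha>) * T powr \<alpha> / (16 * c * (1 - \<alpha>)) * \<Psi>\<^sup>2"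
    unfolding b_def hN[symmetric] by (simp add: power2_eq_square power3_eq_cube mult_ac)
  finally have "norm0 h N (z j) \<le> sqrt (27 * l ^ 3 * Gamma (2 - \<alpha>) * T powr \<alpha> / (16 * c * (1 - \<alpha>)) * \<Psi>\<^sup>2)"
    unfolding norm0_def by (simp only: real_sqrt_le_iff)
  then show ?thesis using \<Psi> unfolding real_sqrt_mult by simp
qed

section \<open>Consistency and convergence\<close>

text \<open>
  The equation holds for \<open>0 < x < l\<close> only; the estimate, being continuous in \<open>x\<close>, extends to the
  boundary nodes, where \<open>H\<^sub>h\<close> evaluates \<open>f\<close>.
\<close>

lemma residual_bound:
  fixes D :: "nat \<Rightarrow> nat \<Rightarrow> real \<Rightarrow> real \<Rightarrow> real" and u f :: "real \<Rightarrow> real \<Rightarrow> real" and k q :: "real \<Rightarrow> real"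
  assumes \<alpha>: "0 < \<alpha>" "\<alpha> < 1" and pos: "0 < l" and \<sigma>: "\<sigma> = 1 - \<alpha> / 2"
    and Du: "\<And>x t. x \<in> {0..l} \<Longrightarrow> t \<in> {0..T} \<Longrightarrow> D 0 0 x t = u x t"
    and Dc: "\<And>a b. a \<le> 6 \<Longrightarrow> b \<le> 3 \<Longrightarrow> continuous_on ({0..l} \<times> {0..T}) (\<lambda>(x, t). D a b x t)"
    and Dx: "\<And>a b x t. a < 6 \<Longrightarrow> b \<le> 3 \<Longrightarrow> x \<in> {0..l} \<Longrightarrow> t \<in> {0..T} \<Longrightarrow>
      ((\<lambda>s. D a b s t) has_real_derivative D (Suc a) b x t) (at x within {0..l})"
    and Dt: "\<And>a b x t. a \<le> 6 \<Longrightarrow> b < 3 \<Longrightarrow> x \<in> {0..l} \<Longrightarrow> t \<in> {0..T} \<Longrightarrow>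
      ((\<lambda>s. D a b x s) has_real_derivative D a (Suc b) x t) (at t within {0..T})"
    and f: "continuous_on ({0..l} \<times> {0..T}) (\<lambda>(x, t). f x t)"
    and eq: "\<And>x t. 0 < x \<Longrightarrow> x < l \<Longrightarrow> 0 < t \<Longrightarrow> t \<le> T \<Longrightarrow> caputo \<alpha> (\<lambda>\<eta>. u x \<eta>) t
             = k t * deriv (\<lambda>s. deriv (\<lambda>r. u r t) s) x - q t * u x t + f x t"
    and B: "\<And>x t. x \<in> {0..l} \<Longrightarrow> t \<in> {0..T} \<Longrightarrow> \<bar>D 0 3 x t\<bar> \<le> B"
    and \<tau>: "0 < \<tau>" "real (j + 1) * \<tau> \<le> T" and x: "x \<in> {0..l}"
  defines "\<theta> \<equiv> (real j + \<sigma>) * \<tau>"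
  shows "\<bar>disc_frac \<alpha> \<sigma> \<tau> j (\<lambda>s. D 0 0 x (real s * \<tau>)) - k \<theta> * D 2 0 x \<theta> + q \<theta> * D 0 0 x \<theta> - f x \<theta>\<bar>
    \<le> 2 * B * T powr (1 - \<alpha>) / Gamma (2 - \<alpha>) * \<tau>\<^sup>2"
proof -
  have \<sigma>b: "0 < \<sigma>" "\<sigma> \<le> 1" using \<alpha> \<sigma> by auto
  have "\<theta> \<le> real (j + 1) * \<tau>" unfolding \<theta>_def using \<tau> \<sigma>b by (intro mult_right_mono) auto
  moreover have "0 < \<theta>" unfolding \<theta>_def using \<tau> \<sigma>b by (intro mult_pos_pos add_nonneg_pos) auto
  ultimately have \<theta>: "0 < \<theta>" "\<theta> \<le> T" using \<tau> by linarith+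
  have node: "real s * \<tau> \<in> {0..T}" if "s \<le> j + 1" for s
    using that \<tau> by (auto intro!: order_trans[OF mult_right_mono \<tau>(2)])
  have inner: "\<bar>disc_frac \<alpha> \<sigma> \<tau> j (\<lambda>s. D 0 0 x (real s * \<tau>)) - k \<theta> * D 2 0 x \<theta> + q \<theta> * D 0 0 x \<theta> - f x \<theta>\<bar>
    \<le> 2 * B * T powr (1 - \<alpha>) / Gamma (2 - \<alpha>) * \<tau>\<^sup>2" if x: "x \<in> {0<..<l}" for x
  proof -
    \<comment> \<open>The equation is stated with the two-sided \<open>deriv\<close> of
      \<open>u\<close>, whereas \<open>D\<close> supplies derivatives within closed intervals. The
      two are identified at interior points, where an open neighbourhood is available.\<close>
    have ux: "((\<lambda>r. u r \<theta>) has_real_derivative D 1 0 s \<theta>) (at s)" if s: "s \<in> {0<..<l}" for s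
    proof (rule has_field_derivative_transform_within_open)
      show "((\<lambda>r. D 0 0 r \<theta>) has_real_derivative D 1 0 s \<theta>) (at s)"
        using Dx[of 0 0 s \<theta>] s \<theta> by (simp add: at_within_Icc_at)
      show "D 0 0 r \<theta> = u r \<theta>" if "r \<in> {0<..<l}" for r using that \<theta> by (auto intro!: Du)
    qed (use s in auto)
    have "((\<lambda>s. deriv (\<lambda>r. u r \<theta>) s) has_real_derivative D 2 0 x \<theta>) (at x)"
    proof (rule has_field_derivative_transform_within_open)
      show "((\<lambda>r. D 1 0 r \<theta>) has_real_derivative D 2 0 x \<theta>) (at x)"
        using Dx[of 1 0 x \<theta>] x \<theta> by (simp add: at_within_Icc_at numeral_2_eq_2)
      show "D 1 0 s \<theta> = deriv (\<lambda>r. u r \<theta>) s" if "s \<in> {0<..<l}" for s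
        using DERIV_imp_deriv[OF ux[OF that]] by simp
    qed (use x in auto)
    then have dxx: "deriv (\<lambda>s. deriv (\<lambda>r. u r \<theta>) s) x = D 2 0 x \<theta>" by (rule DERIV_imp_deriv)
    have dt: "deriv (\<lambda>\<eta>. u x \<eta>) \<eta> = D 0 1 x \<eta>" if \<eta>: "\<eta> \<in> {0<..<\<theta>}" for \<eta>
    proof (rule DERIV_imp_deriv, rule has_field_derivative_transform_within_open)
      show "((\<lambda>s. D 0 0 x s) has_real_derivative D 0 1 x \<eta>) (at \<eta>)"
        using Dt[of 0 0 x \<eta>] \<eta> x \<theta> by (simp add: at_within_Icc_at)
      show "D 0 0 x s = u x s" if "s \<in> {0<..<\<theta>}" for s using that \<theta> x by (auto intro!: Du)
    qed (use \<eta> in auto)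
    \<comment> \<open>The identification of the time derivative is available between 0 and \<theta>;
      the two end points form a null set.\<close>
    have "caputo \<alpha> (\<lambda>\<eta>. u x \<eta>) \<theta> = 1 / Gamma (1 - \<alpha>) * integral {0..\<theta>} (\<lambda>\<eta>. D 0 1 x \<eta> * (\<theta> - \<eta>) powr (- \<alpha>))"
      unfolding caputo_def
      by (rule arg_cong[where f = "\<lambda>I. 1 / Gamma (1 - \<alpha>) * I"], rule integral_spike[of "{0, \<theta>}"])
         (auto simp: dt)
    moreover have "\<bar>1 / Gamma (1 - \<alpha>) * integral {0..\<theta>} (\<lambda>\<eta>. D 0 1 x \<eta> * (\<theta> - \<eta>) powr (- \<alpha>))
        - disc_frac \<alpha> \<sigma> \<tau> j (\<lambda>s. D 0 0 x (real s * \<tau>))\<bar> \<le> 2 * B * T powr (1 - \<alpha>) / Gamma (2 - \<alpha>) * \<tau>\<^sup>2"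
      unfolding \<theta>_def using x by (intro caputo_truncation \<alpha> \<sigma> \<tau> Dt B) auto
    moreover have "caputo \<alpha> (\<lambda>\<eta>. u x \<eta>) \<theta> = k \<theta> * D 2 0 x \<theta> - q \<theta> * D 0 0 x \<theta> + f x \<theta>"
      using eq[of x \<theta>] x \<theta> dxx Du[of x \<theta>] by simp
    ultimately show ?thesis by linarith
  qed
  have line: "continuous_on {0..l} (\<lambda>x. (x, t))" "(\<lambda>x. (x, t)) ` {0..l} \<subseteq> {0..l} \<times> {0..T}"
    if "t \<in> {0..T}" for t
    using that by (auto intro!: continuous_intros)
  have sec: "continuous_on {0..l} (\<lambda>x. D a b x t)" if "a \<le> 6" "b \<le> 3" "t \<in> {0..T}" for a b t
    using continuous_on_compose2[OF Dc[OF that(1,2)] line[OF that(3)]] by simp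
  have secf: "continuous_on {0..l} (\<lambda>x. f x \<theta>)"
    using continuous_on_compose2[OF f line[of \<theta>]] \<theta> by simp
  have "continuous_on {0..l} (\<lambda>x. disc_frac \<alpha> \<sigma> \<tau> j (\<lambda>s. D 0 0 x (real s * \<tau>)))"
    unfolding disc_frac_def divide_inverse
    by (intro continuous_on_mult continuous_on_sum continuous_on_diff continuous_on_const sec node) auto
  then have "continuous_on {0..l} (\<lambda>x. \<bar>disc_frac \<alpha> \<sigma> \<tau> j (\<lambda>s. D 0 0 x (real s * \<tau>)) - k \<theta> * D 2 0 x \<theta> + q \<theta> * D 0 0 x \<theta> - f x \<theta>\<bar>)"
    using \<theta> by (intro continuous_intros sec secf) auto
  then show ?thesis
    using continuous_le_on_closure[of "{0<..<l}" _ x, OF _ _ inner] x pos by simp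
qed

lemma continuous_on_Times_bounded:
  fixes F :: "real \<Rightarrow> real \<Rightarrow> real"
  assumes "continuous_on ({0..l} \<times> {0..T}) (\<lambda>(x, t). F x t)"
  obtains B where "\<And>x t. x \<in> {0..l} \<Longrightarrow> t \<in> {0..T} \<Longrightarrow> \<bar>F x t\<bar> \<le> B"
proof -
  have "bounded ((\<lambda>(x, t). F x t) ` ({0..l} \<times> {0..T}))"
    by (intro compact_imp_bounded compact_continuous_image assms compact_Times) auto
  then obtain B where "\<forall>v \<in> (\<lambda>(x, t). F x t) ` ({0..l} \<times> {0..T}). \<bar>v\<bar> \<le> B"
    by (auto simp: bounded_iff)
  then show ?thesis using that[of B] by force
qed

text \<open>\<open>F\<close> stands for the discrete time derivative on the grid, and
  \<open>R\<close> bounds the defect of the equation before \<open>H_h\<close> is applied. The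
  residual splits into \<open>H_h\<close> of that defect, the compact spatial error of the averaged
  solution, and the errors of time averaging in the diffusion and reaction terms.\<close>

lemma compact_scheme_consistency:
  fixes D :: "nat \<Rightarrow> nat \<Rightarrow> real \<Rightarrow> real \<Rightarrow> real"
  assumes h: "0 < h" and i: "1 \<le> i" "real (i + 1) * h \<le> l"
    and \<tau>: "0 < \<tau>" "real (j + 1) * \<tau> \<le> T" and \<sigma>: "0 \<le> \<sigma>" "\<sigma> \<le> 1"
    and Dx: "\<And>a b x t. a < 6 \<Longrightarrow> b \<le> 3 \<Longrightarrow> x \<in> {0..l} \<Longrightarrow> t \<in> {0..T} \<Longrightarrow>
      ((\<lambda>s. D a b s t) has_real_derivative D (Suc a) b x t) (at x within {0..l})"
    and Dt: "\<And>a b x t. a \<le> 6 \<Longrightarrow> b < 3 \<Longrightarrow> x \<in> {0..l} \<Longrightarrow> t \<in> {0..T} \<Longrightarrow>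
      ((\<lambda>s. D a b x s) has_real_derivative D a (Suc b) x t) (at t within {0..T})"
    and B: "\<And>x t. x \<in> {0..l} \<Longrightarrow> t \<in> {0..T} \<Longrightarrow> \<bar>D 6 0 x t\<bar> \<le> B"
      "\<And>x t. x \<in> {0..l} \<Longrightarrow> t \<in> {0..T} \<Longrightarrow> \<bar>D 0 2 x t\<bar> \<le> B"
      "\<And>x t. x \<in> {0..l} \<Longrightarrow> t \<in> {0..T} \<Longrightarrow> \<bar>D 2 2 x t\<bar> \<le> B"
    and a: "\<bar>a\<bar> \<le> K" and d: "\<bar>d\<bar> \<le> K"
    and F: "\<And>m. real m * h \<in> {0..l} \<Longrightarrow>
      \<bar>F m - a * D 2 0 (real m * h) ((real j + \<sigma>) * \<tau>) + d * D 0 0 (real m * h) ((real j + \<sigma>) * \<tau>) - \<phi> m\<bar> \<le> R"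
  defines "v \<equiv> \<lambda>m. \<sigma> * D 0 0 (real m * h) (real (j + 1) * \<tau>) + (1 - \<sigma>) * D 0 0 (real m * h) (real j * \<tau>)"
  shows "\<bar>Hh h F i - a * sdiff h v i + d * Hh h v i - Hh h \<phi> i\<bar> \<le> R + K * (B * h ^ 4) + 2 * (K * (B * \<tau>\<^sup>2))"
proof -
  define \<theta> where "\<theta> = (real j + \<sigma>) * \<tau>"
  define t0 t1 where "t0 = real j * \<tau>" and "t1 = real (j + 1) * \<tau>"
  have t: "t1 = t0 + \<tau>" "\<theta> = t0 + \<sigma> * \<tau>" "0 \<le> t0" "t0 + \<tau> \<le> T"
    using \<tau> by (auto simp: t0_def t1_def \<theta>_def algebra_simps)
  then have tT: "t0 \<in> {0..T}" "t1 \<in> {0..T}" using \<tau> by auto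
  have node: "real m * h \<in> {0..l}" if "m \<le> i + 1" for m
    using that h i by (auto intro!: order_trans[OF mult_right_mono i(2)])
  have H: "\<bar>Hh h w i\<bar> \<le> C" if "\<And>m. m \<le> i + 1 \<Longrightarrow> \<bar>w m\<bar> \<le> C" for w C
    using h by (intro Hh_abs_le that) auto
  define w where "w m = \<sigma> * D 2 0 (real m * h) t1 + (1 - \<sigma>) * D 2 0 (real m * h) t0" for m
  define \<rho> where "\<rho> m = F m - a * D 2 0 (real m * h) \<theta> + d * D 0 0 (real m * h) \<theta> - \<phi> m" for m
  have K0: "0 \<le> K" using a by linarith
  have r1: "\<bar>Hh h \<rho> i\<bar> \<le> R"
    using F node unfolding \<rho>_def \<theta>_def by (intro H) auto
  have r2: "\<bar>sdiff h v i - Hh h w i\<bar> \<le> B * h ^ 4"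
    unfolding v_def w_def t0_def[symmetric] t1_def[symmetric]
  proof (rule compact_difference_consistency[where l = l
        and G = "\<lambda>k x. \<sigma> * D k 0 x t1 + (1 - \<sigma>) * D k 0 x t0"])
    fix x :: real assume x: "x \<in> {0..l}"
    show "((\<lambda>x. \<sigma> * D k 0 x t1 + (1 - \<sigma>) * D k 0 x t0) has_real_derivative
        \<sigma> * D (Suc k) 0 x t1 + (1 - \<sigma>) * D (Suc k) 0 x t0) (at x within {0..l})" if "k \<le> 5" for k
      using that x tT by (intro DERIV_add DERIV_cmult Dx) auto
    have "\<bar>\<sigma> * D 6 0 x t1 + (1 - \<sigma>) * D 6 0 x t0\<bar> \<le> \<sigma> * B + (1 - \<sigma>) * B"
      using \<sigma> B(1)[OF x tT(1)] B(1)[OF x tT(2)]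
      by (intro order_trans[OF abs_triangle_ineq] add_mono) (auto simp: abs_mult intro!: mult_left_mono)
    then show "\<bar>\<sigma> * D 6 0 x t1 + (1 - \<sigma>) * D 6 0 x t0\<bar> \<le> B" by (simp add: algebra_simps)
  qed (use h i in auto)
  have avg: "\<bar>\<sigma> * D k 0 x t1 + (1 - \<sigma>) * D k 0 x t0 - D k 0 x \<theta>\<bar> \<le> B * \<tau>\<^sup>2"
    if "k = 0 \<or> k = 2" "x \<in> {0..l}" for k x
    unfolding t(1,2) by (rule weighted_average_approx[where T = T and G = "\<lambda>b. D k b x"])
      (use that t \<tau> \<sigma> B in \<open>auto intro!: Dt\<close>)
  have r3: "\<bar>Hh h (\<lambda>m. w m - D 2 0 (real m * h) \<theta>) i\<bar> \<le> B * \<tau>\<^sup>2"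
    unfolding w_def by (intro H avg node) auto
  have r4: "\<bar>Hh h (\<lambda>m. v m - D 0 0 (real m * h) \<theta>) i\<bar> \<le> B * \<tau>\<^sup>2"
    unfolding v_def t0_def[symmetric] t1_def[symmetric] by (intro H avg node) auto
  have "Hh h F i - a * sdiff h v i + d * Hh h v i - Hh h \<phi> i
      = Hh h \<rho> i - a * (sdiff h v i - Hh h w i) - a * Hh h (\<lambda>m. w m - D 2 0 (real m * h) \<theta>) i
        + d * Hh h (\<lambda>m. v m - D 0 0 (real m * h) \<theta>) i"
    unfolding \<rho>_def by (simp add: Hh_diff Hh_add Hh_cmult algebra_simps)
  moreover have "\<bar>a * (sdiff h v i - Hh h w i)\<bar> \<le> K * (B * h ^ 4)"
    "\<bar>a * Hh h (\<lambda>m. w m - D 2 0 (real m * h) \<theta>) i\<bar> \<le> K * (B * \<tau>\<^sup>2)"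
    "\<bar>d * Hh h (\<lambda>m. v m - D 0 0 (real m * h) \<theta>) i\<bar> \<le> K * (B * \<tau>\<^sup>2)"
    unfolding abs_mult using a d K0 r2 r3 r4 by (intro mult_mono; simp)+
  ultimately show ?thesis using r1 by linarith
qed

text \<open>Compactness bounds each of the finitely many derivatives, and the sum of these bounds
  serves them all. This single constant is fixed before any mesh is chosen.\<close>

lemma smooth_6_3E:
  assumes "smooth_6_3 u l T"
  obtains D B where "\<forall>x\<in>{0..l}. \<forall>t\<in>{0..T}. D 0 0 x t = u x t"
    and "\<forall>a\<le>6. \<forall>b\<le>3. continuous_on ({0..l} \<times> {0..T}) (\<lambda>(x, t). D a b x t)"
    and "\<forall>a<6. \<forall>b\<le>3. \<forall>x\<in>{0..l}. \<forall>t\<in>{0..T}.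
      ((\<lambda>s. D a b s t) has_real_derivative D (Suc a) b x t) (at x within {0..l})"
    and "\<forall>a\<le>6. \<forall>b<3. \<forall>x\<in>{0..l}. \<forall>t\<in>{0..T}.
      ((\<lambda>s. D a b x s) has_real_derivative D a (Suc b) x t) (at t within {0..T})"
    and "0 \<le> B" and "\<forall>a\<le>6. \<forall>b\<le>3. \<forall>x\<in>{0..l}. \<forall>t\<in>{0..T}. \<bar>D a b x t\<bar> \<le> B"
proof -
  obtain D where D: "\<forall>x\<in>{0..l}. \<forall>t\<in>{0..T}. D 0 0 x t = u x t"
    "\<forall>a\<le>6. \<forall>b\<le>3. continuous_on ({0..l} \<times> {0..T}) (\<lambda>(x, t). D a b x t)"
    "\<forall>a<6. \<forall>b\<le>3. \<forall>x\<in>{0..l}. \<forall>t\<in>{0..T}.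
      ((\<lambda>s. D a b s t) has_real_derivative D (Suc a) b x t) (at x within {0..l})"
    "\<forall>a\<le>6. \<forall>b<3. \<forall>x\<in>{0..l}. \<forall>t\<in>{0..T}.
      ((\<lambda>s. D a b x s) has_real_derivative D a (Suc b) x t) (at t within {0..T})"
    using assms unfolding smooth_6_3_def by (elim exE conjE)
  have "\<exists>B. \<forall>x\<in>{0..l}. \<forall>t\<in>{0..T}. \<bar>D a b x t\<bar> \<le> B" if "a \<le> 6" "b \<le> 3" for a b
    using continuous_on_Times_bounded[OF D(2)[rule_format, OF that]] by metis
  then obtain \<beta> where \<beta>: "\<And>a b x t. a \<le> 6 \<Longrightarrow> b \<le> 3 \<Longrightarrow> x \<in> {0..l} \<Longrightarrow> t \<in> {0..T} \<Longrightarrow> \<bar>D a b x t\<bar> \<le> \<beta> a b"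
    by metis
  let ?B = "\<Sum>(a, b)\<in>{..6} \<times> {..3}. \<bar>\<beta> a b\<bar>"
  have "\<bar>D a b x t\<bar> \<le> ?B" if ab: "a \<le> 6" "b \<le> 3" and xt: "x \<in> {0..l}" "t \<in> {0..T}" for a b x t
  proof -
    have "\<bar>\<beta> a b\<bar> \<le> ?B"
      using member_le_sum[of "(a, b)" "{..6} \<times> {..3}" "\<lambda>(a, b). \<bar>\<beta> a b\<bar>"] ab by auto
    then show ?thesis using \<beta>[OF ab xt] by linarith
  qed
  moreover have "0 \<le> ?B" by (intro sum_nonneg) auto
  ultimately show ?thesis using that[OF D] by blast
qed

theorem theorem5:
  fixes \<alpha> l T c\<^sub>1 :: real
    and k q :: "real \<Rightarrow> real"
    and f u :: "real \<Rightarrow> real \<Rightarrow> real"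
    and u\<^sub>0 :: "real \<Rightarrow> real"
  assumes "0 < \<alpha>" "\<alpha> < 1" "0 < l" "0 < T" "0 < c\<^sub>1"
    and "continuous_on {0..T} k" "\<forall>t\<in>{0..T}. k t \<ge> c\<^sub>1"
    and "continuous_on {0..T} q" "\<forall>t\<in>{0..T}. q t \<ge> 0"
    and "continuous_on ({0..l} \<times> {0..T}) (\<lambda>(x, t). f x t)"
    and "smooth_6_3 u l T"
    and "\<forall>x t. 0 < x \<and> x < l \<and> 0 < t \<and> t \<le> T \<longrightarrow>
           caputo \<alpha> (\<lambda>\<eta>. u x \<eta>) t
             = k t * deriv (\<lambda>s. deriv (\<lambda>r. u r t) s) x - q t * u x t + f x t"
    and "\<forall>t\<in>{0..T}. u 0 t = 0 \<and> u l t = 0"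
    and "\<forall>x\<in>{0..l}. u x 0 = u\<^sub>0 x"
  shows "\<exists>C>0. \<forall>(N::nat) (M::nat) (y :: nat \<Rightarrow> nat \<Rightarrow> real).
     let h = l / real N; \<tau> = T / real M; \<sigma> = 1 - \<alpha> / 2 in
     (N \<ge> 1 \<and> M \<ge> 1
      \<and> (\<forall>i j. 1 \<le> i \<and> i \<le> N - 1 \<and> j \<le> M - 1 \<longrightarrow>
            disc_frac \<alpha> \<sigma> \<tau> j (\<lambda>s. Hh h (y s) i)
              = k ((real j + \<sigma>) * \<tau>) * sdiff h (\<lambda>m. \<sigma> * y (j + 1) m + (1 - \<sigma>) * y j m) i
                - q ((real j + \<sigma>) * \<tau>) * Hh h (\<lambda>m. \<sigma> * y (j + 1) m + (1 - \<sigma>) * y j m) i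
                + Hh h (\<lambda>m. f (real m * h) ((real j + \<sigma>) * \<tau>)) i)
      \<and> (\<forall>j\<le>M. y j 0 = 0 \<and> y j N = 0)
      \<and> (\<forall>i\<le>N. y 0 i = u\<^sub>0 (real i * h)))
     \<longrightarrow> (\<forall>j. 1 \<le> j \<and> j \<le> M \<longrightarrow>
           norm0 h N (\<lambda>i. u (real i * h) (real j * \<tau>) - y j i) \<le> C * (\<tau>\<^sup>2 + h ^ 4))"
proof -
  note \<alpha> = \<open>0 < \<alpha>\<close> \<open>\<alpha> < 1\<close>
  obtain D B where D: "\<forall>x\<in>{0..l}. \<forall>t\<in>{0..T}. D 0 0 x t = u x t"
    "\<forall>a\<le>6. \<forall>b\<le>3. continuous_on ({0..l} \<times> {0..T}) (\<lambda>(x, t). D a b x t)"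
    "\<forall>a<6. \<forall>b\<le>3. \<forall>x\<in>{0..l}. \<forall>t\<in>{0..T}.
      ((\<lambda>s. D a b s t) has_real_derivative D (Suc a) b x t) (at x within {0..l})"
    "\<forall>a\<le>6. \<forall>b<3. \<forall>x\<in>{0..l}. \<forall>t\<in>{0..T}.
      ((\<lambda>s. D a b x s) has_real_derivative D a (Suc b) x t) (at t within {0..T})"
    and B0: "0 \<le> B" and B: "\<forall>a\<le>6. \<forall>b\<le>3. \<forall>x\<in>{0..l}. \<forall>t\<in>{0..T}. \<bar>D a b x t\<bar> \<le> B"
    by (rule smooth_6_3E[OF \<open>smooth_6_3 u l T\<close>])
  note Du = D(1)[rule_format] and Dc = D(2)[rule_format] and Dx = D(3)[rule_format] and Dt = D(4)[rule_format]
  have B: "\<bar>D 0 3 x t\<bar> \<le> B" "\<bar>D 6 0 x t\<bar> \<le> B" "\<bar>D 0 2 x t\<bar> \<le> B" "\<bar>D 2 2 x t\<bar> \<le> B"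
    if "x \<in> {0..l}" "t \<in> {0..T}" for x t
    using B that by simp_all
  have eq: "caputo \<alpha> (\<lambda>\<eta>. u x \<eta>) t = k t * deriv (\<lambda>s. deriv (\<lambda>r. u r t) s) x - q t * u x t + f x t"
    if "0 < x" "x < l" "0 < t" "t \<le> T" for x t
    using assms(12) that by blast
  have "bounded (k ` {0..T})" "bounded (q ` {0..T})"
    using assms by (intro compact_imp_bounded compact_continuous_image; simp)+
  then obtain K\<^sub>1 K\<^sub>2 where "\<forall>v\<in>k ` {0..T}. \<bar>v\<bar> \<le> K\<^sub>1" "\<forall>v\<in>q ` {0..T}. \<bar>v\<bar> \<le> K\<^sub>2"
    unfolding bounded_iff real_norm_def by blast
  then have K: "\<bar>k t\<bar> \<le> max K\<^sub>1 K\<^sub>2" "\<bar>q t\<bar> \<le> max K\<^sub>1 K\<^sub>2" if "t \<in> {0..T}" for t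
    using that by (auto simp: le_max_iff_disj)
  define K where "K = max K\<^sub>1 K\<^sub>2"
  have K0: "0 \<le> K" using K(1)[of 0] \<open>0 < T\<close> by (simp add: K_def)
  define C\<^sub>0 where "C\<^sub>0 = 2 * B * T powr (1 - \<alpha>) / Gamma (2 - \<alpha>)"
  \<comment> \<open>The three multiples of \<open>K * B\<close> are one for the spatial error and
    two for time averaging, in the diffusion and in the reaction term.\<close>
  define C\<^sub>1 where "C\<^sub>1 = C\<^sub>0 + 3 * (K * B)"
  define C\<^sub>2 where "C\<^sub>2 = sqrt (27 * l ^ 3 * Gamma (2 - \<alpha>) * T powr \<alpha> / (16 * c\<^sub>1 * (1 - \<alpha>)))"
  have C: "0 \<le> C\<^sub>0" "0 \<le> C\<^sub>1" "0 \<le> C\<^sub>2"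
    unfolding C\<^sub>1_def C\<^sub>0_def C\<^sub>2_def using B0 K0 assms(1-5) by auto
  show ?thesis
  \<comment> \<open>\<open>C\<^sub>2 * C\<^sub>1\<close> may vanish, for instance when
    \<open>B\<close> is 0; the added 1 makes the constant strictly positive.\<close>
  proof (intro exI[of _ "C\<^sub>2 * C\<^sub>1 + 1"] conjI allI)
    show "0 < C\<^sub>2 * C\<^sub>1 + 1" using C by (simp add: add_nonneg_pos)
    fix N M :: nat and y :: "nat \<Rightarrow> nat \<Rightarrow> real"
    define h \<tau> \<sigma> where h: "h = l / real N" and \<tau>: "\<tau> = T / real M" and \<sigma>: "\<sigma> = 1 - \<alpha> / 2"
    have main: "norm0 h N (\<lambda>i. u (real i * h) (real j * \<tau>) - y j i) \<le> (C\<^sub>2 * C\<^sub>1 + 1) * (\<tau>\<^sup>2 + h ^ 4)"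
      if NM: "1 \<le> N" "1 \<le> M" and jM: "j \<le> M"
        and scheme: "\<forall>i j. 1 \<le> i \<and> i \<le> N - 1 \<and> j \<le> M - 1 \<longrightarrow>
            disc_frac \<alpha> \<sigma> \<tau> j (\<lambda>s. Hh h (y s) i)
              = k ((real j + \<sigma>) * \<tau>) * sdiff h (\<lambda>m. \<sigma> * y (j + 1) m + (1 - \<sigma>) * y j m) i
                - q ((real j + \<sigma>) * \<tau>) * Hh h (\<lambda>m. \<sigma> * y (j + 1) m + (1 - \<sigma>) * y j m) i
                + Hh h (\<lambda>m. f (real m * h) ((real j + \<sigma>) * \<tau>)) i"
        and boundary: "\<forall>j\<le>M. y j 0 = 0 \<and> y j N = 0" and initial: "\<forall>i\<le>N. y 0 i = u\<^sub>0 (real i * h)" for j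
    proof -
      define U where "U s m = D 0 0 (real m * h) (real s * \<tau>)" for s m
      define z where "z s m = U s m - y s m" for s m
      define a d where "a j = k ((real j + \<sigma>) * \<tau>)" and "d j = q ((real j + \<sigma>) * \<tau>)" for j :: nat
      \<comment> \<open>With \<psi> defined as the residual of the error, the error satisfies the
        scheme by construction. Since \<open>y\<close> solves the difference scheme,
        \<open>\<psi>_eq\<close> identifies \<psi> with the residual of the exact solution.\<close>
      define \<psi> where "\<psi> j i = disc_frac \<alpha> \<sigma> \<tau> j (\<lambda>s. Hh h (z s) i)
        - a j * sdiff h (\<lambda>m. \<sigma> * z (j + 1) m + (1 - \<sigma>) * z j m) i
        + d j * Hh h (\<lambda>m. \<sigma> * z (j + 1) m + (1 - \<sigma>) * z j m) i" for j i
      have h0: "0 < h" and hN: "real N * h = l" and \<tau>0: "0 < \<tau>" and \<tau>M: "real M * \<tau> = T"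
        using h \<tau> NM \<open>0 < l\<close> \<open>0 < T\<close> by auto
      have \<sigma>b: "0 \<le> \<sigma>" "\<sigma> \<le> 1" using \<sigma> \<alpha> by auto
      have node: "real i * h \<in> {0..l}" if "i \<le> N" for i
        using that h0 unfolding hN[symmetric] by (auto intro!: mult_right_mono)
      have tnode: "real j * \<tau> \<in> {0..T}" if "j \<le> M" for j
        using that \<tau>0 unfolding \<tau>M[symmetric] by (auto intro!: mult_right_mono)
      have \<theta>: "(real j + \<sigma>) * \<tau> \<in> {0..T}" if "j < M" for j
        using that \<tau>0 \<sigma>b unfolding \<tau>M[symmetric] by (auto intro!: mult_right_mono)
      have \<tau>j: "real (j + 1) * \<tau> \<le> T" if "j < M" for j
        using tnode[of "j + 1"] that by simp
      have \<psi>_le: "\<bar>\<psi> j i\<bar> \<le> C\<^sub>1 * (\<tau>\<^sup>2 + h ^ 4)" if i: "i \<in> {1..N - 1}" and j: "j < M" for i j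
      proof -
        have comb: "(\<lambda>m. \<sigma> * z (j + 1) m + (1 - \<sigma>) * z j m)
            = (\<lambda>m. (\<sigma> * U (j + 1) m + (1 - \<sigma>) * U j m) - (\<sigma> * y (j + 1) m + (1 - \<sigma>) * y j m))"
          by (simp add: z_def algebra_simps)
        have Hz: "Hh h (z s) i = Hh h (U s) i - Hh h (y s) i" for s
          unfolding z_def by (rule Hh_diff)
        have "1 \<le> i" "i \<le> N - 1" "j \<le> M - 1" using i j by auto
        then have \<psi>_eq: "\<psi> j i = Hh h (\<lambda>m. disc_frac \<alpha> \<sigma> \<tau> j (\<lambda>s. U s m)) i
          - a j * sdiff h (\<lambda>m. \<sigma> * U (j + 1) m + (1 - \<sigma>) * U j m) i
          + d j * Hh h (\<lambda>m. \<sigma> * U (j + 1) m + (1 - \<sigma>) * U j m) i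
          - Hh h (\<lambda>m. f (real m * h) ((real j + \<sigma>) * \<tau>)) i"
          using scheme[rule_format, of i j] h0
          unfolding \<psi>_def comb sdiff_diff Hh_diff Hz disc_frac_diff a_def d_def
          by (simp add: disc_frac_Hh right_diff_distrib)
        have "\<bar>\<psi> j i\<bar> \<le> C\<^sub>0 * \<tau>\<^sup>2 + K * (B * h ^ 4) + 2 * (K * (B * \<tau>\<^sup>2))"
          unfolding \<psi>_eq U_def
        proof (rule compact_scheme_consistency[where l = l and T = T and D = D])
          show "real (i + 1) * h \<le> l" using node[of "i + 1"] i NM by auto
          show "\<bar>a j\<bar> \<le> K" "\<bar>d j\<bar> \<le> K" using K[OF \<theta>[OF j]] by (simp_all add: a_def d_def K_def)
          show "\<bar>disc_frac \<alpha> \<sigma> \<tau> j (\<lambda>s. D 0 0 (real m * h) (real s * \<tau>))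
              - a j * D 2 0 (real m * h) ((real j + \<sigma>) * \<tau>) + d j * D 0 0 (real m * h) ((real j + \<sigma>) * \<tau>)
              - f (real m * h) ((real j + \<sigma>) * \<tau>)\<bar> \<le> C\<^sub>0 * \<tau>\<^sup>2" if "real m * h \<in> {0..l}" for m
            unfolding a_def d_def C\<^sub>0_def
            by (rule residual_bound[where l = l and u = u and D = D];
                (rule \<alpha> \<open>0 < l\<close> \<sigma> \<tau>0 \<tau>j[OF j] that \<open>continuous_on ({0..l} \<times> {0..T}) (\<lambda>(x, t). f x t)\<close> Du Dc Dx Dt eq B(1); assumption?))
        qed (rule h0 \<tau>0 \<tau>j[OF j] \<sigma>b Dx Dt B(2-4) \<open>1 \<le> i\<close>; assumption?)+
        also have "\<dots> \<le> C\<^sub>0 * (\<tau>\<^sup>2 + h ^ 4) + 3 * (K * B) * (\<tau>\<^sup>2 + h ^ 4)"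
        proof -
          have "0 \<le> K * B * h ^ 4" "0 \<le> K * B * \<tau>\<^sup>2" "0 \<le> C\<^sub>0 * h ^ 4"
            using K0 B0 C by auto
          then show ?thesis by (simp add: algebra_simps)
        qed
        also have "\<dots> = C\<^sub>1 * (\<tau>\<^sup>2 + h ^ 4)" by (simp add: C\<^sub>1_def distrib_right)
        finally show ?thesis .
      qed
      have "norm0 h N (z j) \<le> C\<^sub>2 * (C\<^sub>1 * (\<tau>\<^sup>2 + h ^ 4))"
        unfolding C\<^sub>2_def
      proof (rule compact_scheme_stability[where M = M and a = a and d = d and \<psi> = \<psi> and T = T and \<tau> = \<tau>])
        show "c\<^sub>1 \<le> a j" "0 \<le> d j" if "j < M" for j
          using \<theta>[OF that] assms by (simp_all add: a_def d_def)
        show "z j 0 = 0" "z j N = 0" if "j \<le> M" for j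
          using that boundary assms Du[OF node tnode, of 0 j] Du[OF node tnode, of N j] tnode[OF that] hN
          by (simp_all add: z_def U_def)
        show "z 0 i = 0" if "i \<le> N" for i
          using that initial assms Du[OF node[OF that] tnode[of 0]] node[OF that] by (simp add: z_def U_def)
        show "disc_frac \<alpha> \<sigma> \<tau> j (\<lambda>s. Hh h (z s) i)
          = a j * sdiff h (\<lambda>m. \<sigma> * z (j + 1) m + (1 - \<sigma>) * z j m) i
            - d j * Hh h (\<lambda>m. \<sigma> * z (j + 1) m + (1 - \<sigma>) * z j m) i + \<psi> j i" for i j
          by (simp add: \<psi>_def)
        show "\<bar>\<psi> j i\<bar> \<le> C\<^sub>1 * (\<tau>\<^sup>2 + h ^ 4)" if "i \<in> {1..N - 1}" "j < M" for i j
          by (rule \<psi>_le[OF that])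
      qed (use assms NM h \<tau> \<sigma> jM C h0 in auto)
      also have "\<dots> \<le> (C\<^sub>2 * C\<^sub>1 + 1) * (\<tau>\<^sup>2 + h ^ 4)"
        by (simp add: distrib_right)
      also have "norm0 h N (z j) = norm0 h N (\<lambda>i. u (real i * h) (real j * \<tau>) - y j i)"
        unfolding norm0_def z_def U_def using Du node tnode[OF jM]
        by (intro arg_cong[where f = sqrt] sum.cong refl) auto
      finally show ?thesis .
    qed
    show "let h = l / real N; \<tau> = T / real M; \<sigma> = 1 - \<alpha> / 2 in
     (N \<ge> 1 \<and> M \<ge> 1
      \<and> (\<forall>i j. 1 \<le> i \<and> i \<le> N - 1 \<and> j \<le> M - 1 \<longrightarrow>
            disc_frac \<alpha> \<sigma> \<tau> j (\<lambda>s. Hh h (y s) i)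
              = k ((real j + \<sigma>) * \<tau>) * sdiff h (\<lambda>m. \<sigma> * y (j + 1) m + (1 - \<sigma>) * y j m) i
                - q ((real j + \<sigma>) * \<tau>) * Hh h (\<lambda>m. \<sigma> * y (j + 1) m + (1 - \<sigma>) * y j m) i
                + Hh h (\<lambda>m. f (real m * h) ((real j + \<sigma>) * \<tau>)) i)
      \<and> (\<forall>j\<le>M. y j 0 = 0 \<and> y j N = 0)
      \<and> (\<forall>i\<le>N. y 0 i = u\<^sub>0 (real i * h)))
     \<longrightarrow> (\<forall>j. 1 \<le> j \<and> j \<le> M \<longrightarrow>
           norm0 h N (\<lambda>i. u (real i * h) (real j * \<tau>) - y j i) \<le> (C\<^sub>2 * C\<^sub>1 + 1) * (\<tau>\<^sup>2 + h ^ 4))"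
      unfolding Let_def h[symmetric] \<tau>[symmetric] \<sigma>[symmetric] using main by blast
  qed
qed

end
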